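(* (1) The axioms of weakly Euclidean fields (with intuitionistic logic) do not prove Markov's principle $\forall x\,(\neg\neg P(x)\to P(x))$. (2) The geometric theory EG (with intuitionistic logic) does not prove the geometric Markov principle $\forall a,b,c\,(\neg\neg\mathbf{B}(a,b,c)\to\mathbf{B}(a,b,c))$.
   Context: Weakly Euclidean field theory is the intuitionistic first-order theory in the language $0,1,+,-,\cdot$ and a unary predicate $P$ ("is positive") whose axioms are those of commutative rings together with: $\neg x\neq y\to x=y$; $0\neq 1$; $P(x)\to\exists y\,(x\cdot y=1\land P(y))$; $P(x)\land P(y)\to P(x+y)\land P(x\cdot y)$; $x+y=0\to\neg(P(x)\land P(y))$; $x+y=0\land\neg P(x)\land\neg P(y)\to x=0$; $x+y=0\land\neg P(y)\to\exists z\,(z\cdot z=x)$. EG is the following first-order theory over intuitionistic predicate logic with equality. Variables range over points; the primitive relations are a ternary relation $\mathbf{B}(a,b,c)$ (strict betweenness) and a quaternary relation $E(a,b,c,d)$, written $ab=cd$ (congruence of segments). Abbreviations: $a\#b$ means $\exists e\,(\mathbf{B}(e,a,b)\lor\mathbf{B}(a,e,b)\lor\mathbf{B}(a,b,e))$; $\mathrm{T}(a,b,c)$ means $\neg(a\neq b\land b\neq c\land\neg\mathbf{B}(a,b,c))$; $Ray(a,b,x)$ ($x$ lies on the ray from $a$ through $b$) means $\exists d\,(\mathbf{B}(d,a,b)\land\mathrm{T}(d,a,x))$; $R(a,b,c)$ ($abc$ is a right angle) means $\exists d\,(\mathbf{B}(a,b,d)\land ab=bd\land ac=dc\land a\#b\land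 c\#b\land a\#c)$; $apex(a,b,c)$ means $\exists u,v\,(Ray(b,a,u)\land Ray(b,c,v)\land bu=bv\land b\#u\land u\#v)$; $\angle abc\cong\angle ABC$ means $\exists u,v,U,V\,(Ray(b,a,u)\land Ray(b,c,v)\land Ray(B,A,U)\land Ray(B,C,V)\land bu=BU\land bv=BV\land uv=UV)$; $0<abc$ means $apex(a,b,c)\lor R(a,b,c)\lor\exists A,B,C\,(\angle abc\cong\angle ABC\land(R(B,A,C)\lor R(B,C,A)))$; $abc<\pi$ means $\exists d\,(\mathbf{B}(a,b,d)\land 0<dbc)$; $0<abc<\pi$ means $0<abc\land abc<\pi$. Axioms: (congruence) $ab=ba$; $ab=pq\land ab=rs\to pq=rs$; $ab=cc\to a=b$; $\neg\neg\,ab=cd\to ab=cd$. (betweenness) $\neg\mathbf{B}(a,b,a)$; $\mathbf{B}(a,b,c)\to\mathbf{B}(c,b,a)$; $\mathbf{B}(a,b,d)\land\mathbf{B}(b,c,d)\to\mathbf{B}(a,b,c)$; $\mathbf{B}(a,b,d)\land\mathbf{B}(a,c,d)\land\neg\mathbf{B}(a,b,c)\land\neg\mathbf{B}(a,c,b)\to b=c$. (extension) $A\#B\land ab=AB\to\exists e\,(\mathrm{T}(a,b,e)\land be=cd)$; $A\#B\land ab=AB\land C\#D\land cd=CD\to\exists e\,(\mathbf{B}(a,b,e)\land be=cd)$. (five-segment) $a\#b\land\mathrm{T}(a,b,c)\land\mathrm{T}(A,B,C)\land ab=AB\land bc=BC\land ad=AD\land bd=BD\to cd=CD$. (inner Pasch)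 $\mathbf{B}(a,p,c)\land\mathbf{B}(b,q,c)\land(0<acb<\pi\lor 0<qpa<\pi)\to\exists x\,(\mathbf{B}(p,x,b)\land\mathbf{B}(a,x,q))$. (outer Pasch) $\mathbf{B}(a,p,c)\land\mathbf{B}(b,c,q)\land(0<baq<\pi\lor 0<abq<\pi)\to\exists x\,(\mathbf{B}(b,p,x)\land\mathbf{B}(a,x,q))$. (lower dimension) constants $\alpha,\beta,\gamma,c_1,c_2,c_3,c_4$ with $\alpha\beta=\beta\gamma$, $\alpha\beta=\alpha\gamma$, $\alpha\neq\beta$, $\mathbf{B}(\alpha,c_1,\beta)\land\alpha c_1=c_1\beta$, $\mathbf{B}(\alpha,c_2,\gamma)\land\alpha c_2=c_2\gamma$, $\mathbf{B}(\beta,c_3,\gamma)\land\beta c_3=c_3\gamma$, $\mathbf{B}(\beta,c_4,c_2)\land\mathbf{B}(\gamma,c_4,c_1)$. (line-circle) $\mathbf{B}(u,a,v)\land cu=pq\land cv=pq\land\mathbf{B}(u,c,v)\to\exists x,y\,(cx=pq\land cy=pq\land\mathbf{B}(x,a,y))$, and the same with $\mathrm{T}$ in place of $\mathbf{B}$ throughout. (circle-circle) $ca=pq\land\mathrm{T}(u,a,v)\land\mathrm{T}(u,C,v)\land Cu=PQ\land Cv=PQ\land cb=pq\land\mathbf{B}(C,w,b)\land Cw=PQ\to\exists e\,(ce=pq\land Ce=PQ)$. (Euclid 5) $pt=qt\land\mathbf{B}(p,t,q)\land st=rt\land\mathbf{B}(s,t,r)\land pr=qs\land\mathbf{B}(q,a,r)\to\exists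 e\,(\mathbf{B}(p,a,e)\land\mathbf{B}(s,q,e))$. All free variables are universally quantified.
   Formalization: EG as stated is inconsistent, so (2) is proved for a mended EG: Euclid 5 has the extra hypotheses p#a and s#q (both follow from its conclusion), and the definition of angle congruence has the extra conditions b≠u and b≠v, excluding the degenerate witnesses u=v=b. *)

theory Defs
  imports Main
begin

section \<open>Intuitionistic first-order logic with equality\<close>

text \<open>
  Terms and formulas over function symbols \<open>'f\<close> and relation symbols \<open>'p\<close>, with de Bruijn
  indices. Symbols are applied to lists; the arity functions used below restrict attention to
  the expressions that belong to the language.
\<close>

datatype 'f tm = Var nat | Fn 'f "'f tm list"

datatype ('f, 'p) fm =
    Falsum
  | Rel 'p "'f tm list"
  | Eq "'f tm" "'f tm"    (infix \<open>\<^bold>=\<close> 65)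
  | Conj "('f, 'p) fm" "('f, 'p) fm"    (infixr \<open>\<^bold>\<and>\<close> 60)
  | Disj "('f, 'p) fm" "('f, 'p) fm"    (infixr \<open>\<^bold>\<or>\<close> 58)
  | Imp "('f, 'p) fm" "('f, 'p) fm"    (infixr \<open>\<^bold>\<longrightarrow>\<close> 55)
  | All "('f, 'p) fm"
  | Ex "('f, 'p) fm"

abbreviation Neg :: "('f, 'p) fm \<Rightarrow> ('f, 'p) fm"  (\<open>\<^bold>\<not> _\<close> [62] 62)
  where "\<^bold>\<not> \<phi> \<equiv> \<phi> \<^bold>\<longrightarrow> Falsum"

abbreviation Neq :: "'f tm \<Rightarrow> 'f tm \<Rightarrow> ('f, 'p) fm"  (infix \<open>\<^bold>\<noteq>\<close> 65)
  where "s \<^bold>\<noteq> t \<equiv> \<^bold>\<not> (s \<^bold>= t)"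

primrec wf_tm :: "('f \<Rightarrow> nat) \<Rightarrow> 'f tm \<Rightarrow> bool" where
  "wf_tm af (Var i) = True"
| "wf_tm af (Fn f ts) = (length ts = af f \<and> list_all (wf_tm af) ts)"

primrec wf_fm :: "('f \<Rightarrow> nat) \<Rightarrow> ('p \<Rightarrow> nat) \<Rightarrow> ('f, 'p) fm \<Rightarrow> bool" where
  "wf_fm af ap Falsum = True"
| "wf_fm af ap (Rel p ts) = (length ts = ap p \<and> list_all (wf_tm af) ts)"
| "wf_fm af ap (s \<^bold>= t) = (wf_tm af s \<and> wf_tm af t)"
| "wf_fm af ap (\<phi> \<^bold>\<and> \<psi>) = (wf_fm af ap \<phi> \<and> wf_fm af ap \<psi>)"
| "wf_fm af ap (\<phi> \<^bold>\<or> \<psi>) = (wf_fm af ap \<phi> \<and> wf_fm af ap \<psi>)"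
| "wf_fm af ap (\<phi> \<^bold>\<longrightarrow> \<psi>) = (wf_fm af ap \<phi> \<and> wf_fm af ap \<psi>)"
| "wf_fm af ap (All \<phi>) = wf_fm af ap \<phi>"
| "wf_fm af ap (Ex \<phi>) = wf_fm af ap \<phi>"

primrec subst_tm :: "(nat \<Rightarrow> 'f tm) \<Rightarrow> 'f tm \<Rightarrow> 'f tm" where
  "subst_tm \<sigma> (Var i) = \<sigma> i"
| "subst_tm \<sigma> (Fn f ts) = Fn f (map (subst_tm \<sigma>) ts)"

definition shift :: "'f tm \<Rightarrow> nat \<Rightarrow> 'f tm"  (infixl \<open>\<up>\<close> 90)
  where "t \<up> n = subst_tm (\<lambda>i. Var (i + n)) t"

primrec subst_fm :: "(nat \<Rightarrow> 'f tm) \<Rightarrow> ('f, 'p) fm \<Rightarrow> ('f, 'p) fm" where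
  "subst_fm \<sigma> Falsum = Falsum"
| "subst_fm \<sigma> (Rel p ts) = Rel p (map (subst_tm \<sigma>) ts)"
| "subst_fm \<sigma> (s \<^bold>= t) = (subst_tm \<sigma> s \<^bold>= subst_tm \<sigma> t)"
| "subst_fm \<sigma> (\<phi> \<^bold>\<and> \<psi>) = (subst_fm \<sigma> \<phi> \<^bold>\<and> subst_fm \<sigma> \<psi>)"
| "subst_fm \<sigma> (\<phi> \<^bold>\<or> \<psi>) = (subst_fm \<sigma> \<phi> \<^bold>\<or> subst_fm \<sigma> \<psi>)"
| "subst_fm \<sigma> (\<phi> \<^bold>\<longrightarrow> \<psi>) = (subst_fm \<sigma> \<phi> \<^bold>\<longrightarrow> subst_fm \<sigma> \<psi>)"
| "subst_fm \<sigma> (All \<phi>) = All (subst_fm (case_nat (Var 0) (\<lambda>i. \<sigma> i \<up> 1)) \<phi>)"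
| "subst_fm \<sigma> (Ex \<phi>) = Ex (subst_fm (case_nat (Var 0) (\<lambda>i. \<sigma> i \<up> 1)) \<phi>)"

definition lift_fm :: "('f, 'p) fm \<Rightarrow> ('f, 'p) fm"
  where "lift_fm \<phi> = subst_fm (\<lambda>i. Var (Suc i)) \<phi>"

definition inst :: "'f tm \<Rightarrow> ('f, 'p) fm \<Rightarrow> ('f, 'p) fm"
  where "inst t \<phi> = subst_fm (case_nat t Var) \<phi>"

text \<open>
  Natural deduction. In \<open>AllI\<close> and \<open>ExE\<close> lifting renders the eigenvariable condition:
  index 0 is fresh for the lifted hypotheses.
\<close>

inductive deriv :: "('f \<Rightarrow> nat) \<Rightarrow> ('p \<Rightarrow> nat) \<Rightarrow> ('f, 'p) fm set \<Rightarrow> ('f, 'p) fm \<Rightarrow> bool"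
  for af ap where
  Assm:   "\<phi> \<in> \<Gamma> \<Longrightarrow> wf_fm af ap \<phi> \<Longrightarrow> deriv af ap \<Gamma> \<phi>"
| FalseE: "deriv af ap \<Gamma> Falsum \<Longrightarrow> wf_fm af ap \<phi> \<Longrightarrow> deriv af ap \<Gamma> \<phi>"
| ConjI:  "deriv af ap \<Gamma> \<phi> \<Longrightarrow> deriv af ap \<Gamma> \<psi> \<Longrightarrow> deriv af ap \<Gamma> (\<phi> \<^bold>\<and> \<psi>)"
| ConjE1: "deriv af ap \<Gamma> (\<phi> \<^bold>\<and> \<psi>) \<Longrightarrow> deriv af ap \<Gamma> \<phi>"
| ConjE2: "deriv af ap \<Gamma> (\<phi> \<^bold>\<and> \<psi>) \<Longrightarrow> deriv af ap \<Gamma> \<psi>"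
| DisjI1: "deriv af ap \<Gamma> \<phi> \<Longrightarrow> wf_fm af ap \<psi> \<Longrightarrow> deriv af ap \<Gamma> (\<phi> \<^bold>\<or> \<psi>)"
| DisjI2: "deriv af ap \<Gamma> \<psi> \<Longrightarrow> wf_fm af ap \<phi> \<Longrightarrow> deriv af ap \<Gamma> (\<phi> \<^bold>\<or> \<psi>)"
| DisjE:  "deriv af ap \<Gamma> (\<phi> \<^bold>\<or> \<psi>) \<Longrightarrow> deriv af ap (insert \<phi> \<Gamma>) \<chi> \<Longrightarrow>
             deriv af ap (insert \<psi> \<Gamma>) \<chi> \<Longrightarrow> deriv af ap \<Gamma> \<chi>"
| ImpI:   "wf_fm af ap \<phi> \<Longrightarrow> deriv af ap (insert \<phi> \<Gamma>) \<psi> \<Longrightarrow> deriv af ap \<Gamma> (\<phi> \<^bold>\<longrightarrow> \<psi>)"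
| ImpE:   "deriv af ap \<Gamma> (\<phi> \<^bold>\<longrightarrow> \<psi>) \<Longrightarrow> deriv af ap \<Gamma> \<phi> \<Longrightarrow> deriv af ap \<Gamma> \<psi>"
| AllI:   "deriv af ap (lift_fm ` \<Gamma>) \<phi> \<Longrightarrow> deriv af ap \<Gamma> (All \<phi>)"
| AllE:   "deriv af ap \<Gamma> (All \<phi>) \<Longrightarrow> wf_tm af t \<Longrightarrow> deriv af ap \<Gamma> (inst t \<phi>)"
| ExI:    "wf_fm af ap \<phi> \<Longrightarrow> wf_tm af t \<Longrightarrow> deriv af ap \<Gamma> (inst t \<phi>) \<Longrightarrow> deriv af ap \<Gamma> (Ex \<phi>)"
| ExE:    "deriv af ap \<Gamma> (Ex \<phi>) \<Longrightarrow> deriv af ap (insert \<phi> (lift_fm ` \<Gamma>)) (lift_fm \<psi>) \<Longrightarrow>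
             deriv af ap \<Gamma> \<psi>"
| EqI:    "wf_tm af t \<Longrightarrow> deriv af ap \<Gamma> (t \<^bold>= t)"
| EqE:    "wf_fm af ap \<phi> \<Longrightarrow> deriv af ap \<Gamma> (s \<^bold>= t) \<Longrightarrow> deriv af ap \<Gamma> (inst s \<phi>) \<Longrightarrow>
             deriv af ap \<Gamma> (inst t \<phi>)"

text \<open>A strict upper bound for the free indices, and the universal closure.\<close>

primrec bound_tm :: "'f tm \<Rightarrow> nat" where
  "bound_tm (Var i) = Suc i"
| "bound_tm (Fn f ts) = fold max (map bound_tm ts) 0"

primrec bound_fm :: "('f, 'p) fm \<Rightarrow> nat" where
  "bound_fm Falsum = 0"
| "bound_fm (Rel p ts) = fold max (map bound_tm ts) 0"
| "bound_fm (s \<^bold>= t) = max (bound_tm s) (bound_tm t)"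
| "bound_fm (\<phi> \<^bold>\<and> \<psi>) = max (bound_fm \<phi>) (bound_fm \<psi>)"
| "bound_fm (\<phi> \<^bold>\<or> \<psi>) = max (bound_fm \<phi>) (bound_fm \<psi>)"
| "bound_fm (\<phi> \<^bold>\<longrightarrow> \<psi>) = max (bound_fm \<phi>) (bound_fm \<psi>)"
| "bound_fm (All \<phi>) = bound_fm \<phi> - 1"
| "bound_fm (Ex \<phi>) = bound_fm \<phi> - 1"

definition closure :: "('f, 'p) fm \<Rightarrow> ('f, 'p) fm"
  where "closure \<phi> = (All ^^ bound_fm \<phi>) \<phi>"


section \<open>Weakly Euclidean fields\<close>

datatype field_fun = Zero | One | Plus | Minus | Times

datatype field_rel = Positive

primrec field_fun_arity :: "field_fun \<Rightarrow> nat" where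
  "field_fun_arity Zero = 0"
| "field_fun_arity One = 0"
| "field_fun_arity Plus = 2"
| "field_fun_arity Minus = 1"
| "field_fun_arity Times = 2"

primrec field_rel_arity :: "field_rel \<Rightarrow> nat" where
  "field_rel_arity Positive = 1"

type_synonym field_tm = "field_fun tm"
type_synonym field_fm = "(field_fun, field_rel) fm"

abbreviation zero_tm :: field_tm  (\<open>\<^bold>0\<close>) where "\<^bold>0 \<equiv> Fn Zero []"
abbreviation one_tm :: field_tm  (\<open>\<^bold>1\<close>) where "\<^bold>1 \<equiv> Fn One []"
abbreviation plus_tm :: "field_tm \<Rightarrow> field_tm \<Rightarrow> field_tm"  (infixl \<open>\<^bold>+\<close> 70)
  where "x \<^bold>+ y \<equiv> Fn Plus [x, y]"
abbreviation minus_tm :: "field_tm \<Rightarrow> field_tm"  (\<open>\<^bold>- _\<close> [85] 85)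
  where "\<^bold>- x \<equiv> Fn Minus [x]"
abbreviation times_tm :: "field_tm \<Rightarrow> field_tm \<Rightarrow> field_tm"  (infixl \<open>\<^bold>*\<close> 75)
  where "x \<^bold>* y \<equiv> Fn Times [x, y]"
abbreviation Pos :: "field_tm \<Rightarrow> field_fm" where "Pos x \<equiv> Rel Positive [x]"

definition comm_ring_axioms :: "field_fm set" where
  "comm_ring_axioms = closure `
    (let x = Var 0; y = Var 1; z = Var 2 in
     {(x \<^bold>+ y) \<^bold>+ z \<^bold>= x \<^bold>+ (y \<^bold>+ z),
      x \<^bold>+ y \<^bold>= y \<^bold>+ x,
      x \<^bold>+ \<^bold>0 \<^bold>= x,
      x \<^bold>+ \<^bold>- x \<^bold>= \<^bold>0,
      (x \<^bold>* y) \<^bold>* z \<^bold>= x \<^bold>* (y \<^bold>* z),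
      x \<^bold>* y \<^bold>= y \<^bold>* x,
      x \<^bold>* \<^bold>1 \<^bold>= x,
      x \<^bold>* (y \<^bold>+ z) \<^bold>= x \<^bold>* y \<^bold>+ x \<^bold>* z})"

definition weakly_Euclidean_field_axioms :: "field_fm set" where
  "weakly_Euclidean_field_axioms = comm_ring_axioms \<union> closure `
    (let x = Var 0; y = Var 1 in
     {\<^bold>\<not> (x \<^bold>\<noteq> y) \<^bold>\<longrightarrow> x \<^bold>= y,
      \<^bold>0 \<^bold>\<noteq> \<^bold>1,
      Pos x \<^bold>\<longrightarrow> Ex (x\<up>1 \<^bold>* Var 0 \<^bold>= \<^bold>1 \<^bold>\<and> Pos (Var 0)),
      Pos x \<^bold>\<and> Pos y \<^bold>\<longrightarrow> Pos (x \<^bold>+ y) \<^bold>\<and> Pos (x \<^bold>* y),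
      x \<^bold>+ y \<^bold>= \<^bold>0 \<^bold>\<longrightarrow> \<^bold>\<not> (Pos x \<^bold>\<and> Pos y),
      x \<^bold>+ y \<^bold>= \<^bold>0 \<^bold>\<and> \<^bold>\<not> Pos x \<^bold>\<and> \<^bold>\<not> Pos y \<^bold>\<longrightarrow> x \<^bold>= \<^bold>0,
      x \<^bold>+ y \<^bold>= \<^bold>0 \<^bold>\<and> \<^bold>\<not> Pos y \<^bold>\<longrightarrow> Ex (Var 0 \<^bold>* Var 0 \<^bold>= x\<up>1)})"

definition field_Markov :: field_fm where
  "field_Markov = (let x = Var 0 in All (\<^bold>\<not> \<^bold>\<not> Pos x \<^bold>\<longrightarrow> Pos x))"


section \<open>The geometric theory EG\<close>

datatype point_const = Alpha | Beta | Gamma | C1 | C2 | C3 | C4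

datatype point_rel = Between | Congruent

definition point_const_arity :: "point_const \<Rightarrow> nat" where
  "point_const_arity c = 0"

primrec point_rel_arity :: "point_rel \<Rightarrow> nat" where
  "point_rel_arity Between = 3"
| "point_rel_arity Congruent = 4"

type_synonym point_tm = "point_const tm"
type_synonym point_fm = "(point_const, point_rel) fm"

abbreviation B :: "point_tm \<Rightarrow> point_tm \<Rightarrow> point_tm \<Rightarrow> point_fm"
  where "B a b c \<equiv> Rel Between [a, b, c]"

abbreviation E :: "point_tm \<Rightarrow> point_tm \<Rightarrow> point_tm \<Rightarrow> point_tm \<Rightarrow> point_fm"
  where "E a b c d \<equiv> Rel Congruent [a, b, c, d]"

definition apart :: "point_tm \<Rightarrow> point_tm \<Rightarrow> point_fm"  (infix \<open>\<^bold>#\<close> 65) where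
  "a \<^bold># b = Ex (let e = Var 0; a = a\<up>1; b = b\<up>1 in B e a b \<^bold>\<or> B a e b \<^bold>\<or> B a b e)"

definition T :: "point_tm \<Rightarrow> point_tm \<Rightarrow> point_tm \<Rightarrow> point_fm" where
  "T a b c = (\<^bold>\<not> (a \<^bold>\<noteq> b \<^bold>\<and> b \<^bold>\<noteq> c \<^bold>\<and> \<^bold>\<not> B a b c))"

definition Ray :: "point_tm \<Rightarrow> point_tm \<Rightarrow> point_tm \<Rightarrow> point_fm" where
  "Ray a b x = Ex (let d = Var 0; a = a\<up>1; b = b\<up>1; x = x\<up>1 in B d a b \<^bold>\<and> T d a x)"

definition R :: "point_tm \<Rightarrow> point_tm \<Rightarrow> point_tm \<Rightarrow> point_fm" where
  "R a b c = Ex (let d = Var 0; a = a\<up>1; b = b\<up>1; c = c\<up>1 in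
     B a b d \<^bold>\<and> E a b b d \<^bold>\<and> E a c d c \<^bold>\<and> a \<^bold># b \<^bold>\<and> c \<^bold># b \<^bold>\<and> a \<^bold># c)"

definition apex :: "point_tm \<Rightarrow> point_tm \<Rightarrow> point_tm \<Rightarrow> point_fm" where
  "apex a b c = Ex (Ex (let u = Var 1; v = Var 0; a = a\<up>2; b = b\<up>2; c = c\<up>2 in
     Ray b a u \<^bold>\<and> Ray b c v \<^bold>\<and> E b u b v \<^bold>\<and> b \<^bold># u \<^bold>\<and> u \<^bold># v))"

text \<open>
  The conjuncts \<open>b \<^bold>\<noteq> u\<close> and \<open>b \<^bold>\<noteq> v\<close>, absent from the source, exclude degenerate
  witnesses. Since
  \<open>Ray b a b\<close> holds whenever \<open>b \<^bold># a\<close>, without them \<open>u = v = b\<close> and \<open>u' = v' = b'\<close> would make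
  any two angles with nondegenerate sides congruent, and \<open>inner_Pasch\<close> below would then be
  refutable for collinear points.
\<close>

definition angle_cong ::
  "point_tm \<Rightarrow> point_tm \<Rightarrow> point_tm \<Rightarrow> point_tm \<Rightarrow> point_tm \<Rightarrow> point_tm \<Rightarrow> point_fm" where
  "angle_cong a b c a' b' c' = Ex (Ex (Ex (Ex (
     let u = Var 3; v = Var 2; u' = Var 1; v' = Var 0;
         a = a\<up>4; b = b\<up>4; c = c\<up>4; a' = a'\<up>4; b' = b'\<up>4; c' = c'\<up>4 in
     Ray b a u \<^bold>\<and> Ray b c v \<^bold>\<and> Ray b' a' u' \<^bold>\<and> Ray b' c' v' \<^bold>\<and>
     E b u b' u' \<^bold>\<and> E b v b' v' \<^bold>\<and> E u v u' v' \<^bold>\<and> b \<^bold>\<noteq> u \<^bold>\<and> b \<^bold>\<noteq> v))))"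

definition pos_angle :: "point_tm \<Rightarrow> point_tm \<Rightarrow> point_tm \<Rightarrow> point_fm" where
  "pos_angle a b c = (apex a b c \<^bold>\<or> R a b c \<^bold>\<or> Ex (Ex (Ex (
     let a' = Var 2; b' = Var 1; c' = Var 0; a = a\<up>3; b = b\<up>3; c = c\<up>3 in
     angle_cong a b c a' b' c' \<^bold>\<and> (R b' a' c' \<^bold>\<or> R b' c' a')))))"

definition angle_less_pi :: "point_tm \<Rightarrow> point_tm \<Rightarrow> point_tm \<Rightarrow> point_fm" where
  "angle_less_pi a b c = Ex (let d = Var 0; a = a\<up>1; b = b\<up>1; c = c\<up>1 in
     B a b d \<^bold>\<and> pos_angle d b c)"

definition proper_angle :: "point_tm \<Rightarrow> point_tm \<Rightarrow> point_tm \<Rightarrow> point_fm" where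
  "proper_angle a b c = (pos_angle a b c \<^bold>\<and> angle_less_pi a b c)"

text \<open>
  In the axioms below, \<open>a'\<close>, \<open>b'\<close>, \<dots> stand for points customarily named by capital letters.
\<close>

definition congruence_axioms :: "point_fm set" where
  "congruence_axioms =
    (let a = Var 0; b = Var 1; c = Var 2; d = Var 3;
         p = Var 2; q = Var 3; r = Var 4; s = Var 5 in
     {E a b b a,
      E a b p q \<^bold>\<and> E a b r s \<^bold>\<longrightarrow> E p q r s,
      E a b c c \<^bold>\<longrightarrow> a \<^bold>= b,
      \<^bold>\<not> \<^bold>\<not> E a b c d \<^bold>\<longrightarrow> E a b c d})"

definition betweenness_axioms :: "point_fm set" where
  "betweenness_axioms =
    (let a = Var 0; b = Var 1; c = Var 2; d = Var 3 in
     {\<^bold>\<not> B a b a,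
      B a b c \<^bold>\<longrightarrow> B c b a,
      B a b d \<^bold>\<and> B b c d \<^bold>\<longrightarrow> B a b c,
      B a b d \<^bold>\<and> B a c d \<^bold>\<and> \<^bold>\<not> B a b c \<^bold>\<and> \<^bold>\<not> B a c b \<^bold>\<longrightarrow> b \<^bold>= c})"

definition extension_axioms :: "point_fm set" where
  "extension_axioms =
    (let a = Var 0; b = Var 1; c = Var 2; d = Var 3;
         a' = Var 4; b' = Var 5; c' = Var 6; d' = Var 7 in
     {a' \<^bold># b' \<^bold>\<and> E a b a' b' \<^bold>\<longrightarrow>
        Ex (let e = Var 0 in T (a\<up>1) (b\<up>1) e \<^bold>\<and> E (b\<up>1) e (c\<up>1) (d\<up>1)),
      a' \<^bold># b' \<^bold>\<and> E a b a' b' \<^bold>\<and> c' \<^bold># d' \<^bold>\<and> E c d c' d' \<^bold>\<longrightarrow>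
        Ex (let e = Var 0 in B (a\<up>1) (b\<up>1) e \<^bold>\<and> E (b\<up>1) e (c\<up>1) (d\<up>1))})"

definition five_segment :: point_fm where
  "five_segment =
    (let a = Var 0; b = Var 1; c = Var 2; d = Var 3;
         a' = Var 4; b' = Var 5; c' = Var 6; d' = Var 7 in
     a \<^bold># b \<^bold>\<and> T a b c \<^bold>\<and> T a' b' c' \<^bold>\<and> E a b a' b' \<^bold>\<and> E b c b' c' \<^bold>\<and> E a d a' d' \<^bold>\<and> E b d b' d'
       \<^bold>\<longrightarrow> E c d c' d')"

definition inner_Pasch :: point_fm where
  "inner_Pasch =
    (let a = Var 0; b = Var 1; c = Var 2; p = Var 3; q = Var 4 in
     B a p c \<^bold>\<and> B b q c \<^bold>\<and> (proper_angle a c b \<^bold>\<or> proper_angle q p a) \<^bold>\<longrightarrow>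
       Ex (let x = Var 0 in B (p\<up>1) x (b\<up>1) \<^bold>\<and> B (a\<up>1) x (q\<up>1)))"

definition outer_Pasch :: point_fm where
  "outer_Pasch =
    (let a = Var 0; b = Var 1; c = Var 2; p = Var 3; q = Var 4 in
     B a p c \<^bold>\<and> B b c q \<^bold>\<and> (proper_angle b a q \<^bold>\<or> proper_angle a b q) \<^bold>\<longrightarrow>
       Ex (let x = Var 0 in B (b\<up>1) (p\<up>1) x \<^bold>\<and> B (a\<up>1) x (q\<up>1)))"

definition lower_dimension_axioms :: "point_fm set" where
  "lower_dimension_axioms =
    (let \<alpha> = Fn Alpha []; \<beta> = Fn Beta []; \<gamma> = Fn Gamma [];
         c1 = Fn C1 []; c2 = Fn C2 []; c3 = Fn C3 []; c4 = Fn C4 [] in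
     {E \<alpha> \<beta> \<beta> \<gamma>,
      E \<alpha> \<beta> \<alpha> \<gamma>,
      \<alpha> \<^bold>\<noteq> \<beta>,
      B \<alpha> c1 \<beta> \<^bold>\<and> E \<alpha> c1 c1 \<beta>,
      B \<alpha> c2 \<gamma> \<^bold>\<and> E \<alpha> c2 c2 \<gamma>,
      B \<beta> c3 \<gamma> \<^bold>\<and> E \<beta> c3 c3 \<gamma>,
      B \<beta> c4 c2 \<^bold>\<and> B \<gamma> c4 c1})"

definition line_circle_axioms :: "point_fm set" where
  "line_circle_axioms =
    (let a = Var 0; c = Var 1; p = Var 2; q = Var 3; u = Var 4; v = Var 5 in
     {B u a v \<^bold>\<and> E c u p q \<^bold>\<and> E c v p q \<^bold>\<and> B u c v \<^bold>\<longrightarrow>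
        Ex (Ex (let x = Var 1; y = Var 0; a = a\<up>2; c = c\<up>2; p = p\<up>2; q = q\<up>2 in
          E c x p q \<^bold>\<and> E c y p q \<^bold>\<and> B x a y)),
      T u a v \<^bold>\<and> E c u p q \<^bold>\<and> E c v p q \<^bold>\<and> T u c v \<^bold>\<longrightarrow>
        Ex (Ex (let x = Var 1; y = Var 0; a = a\<up>2; c = c\<up>2; p = p\<up>2; q = q\<up>2 in
          E c x p q \<^bold>\<and> E c y p q \<^bold>\<and> T x a y))})"

definition circle_circle :: point_fm where
  "circle_circle =
    (let a = Var 0; b = Var 1; c = Var 2; p = Var 3; q = Var 4; u = Var 5; v = Var 6; w = Var 7;
         c' = Var 8; p' = Var 9; q' = Var 10 in
     E c a p q \<^bold>\<and> T u a v \<^bold>\<and> T u c' v \<^bold>\<and> E c' u p' q' \<^bold>\<and> E c' v p' q' \<^bold>\<and>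
     E c b p q \<^bold>\<and> B c' w b \<^bold>\<and> E c' w p' q' \<^bold>\<longrightarrow>
       Ex (let e = Var 0 in E (c\<up>1) e (p\<up>1) (q\<up>1) \<^bold>\<and> E (c'\<up>1) e (p'\<up>1) (q'\<up>1)))"

text \<open>
  The hypotheses \<open>p \<^bold># a\<close> and \<open>s \<^bold># q\<close>, absent from the source, are immediate
  consequences of the conclusion. They rule out degenerate parallelograms: for \<open>r = p\<close>, \<open>s = q\<close>, \<open>a = t\<close> the remaining hypotheses
  hold for the midpoint \<open>t\<close> of any segment \<open>pq\<close>, while the conclusion requires \<open>B q q e\<close>.
\<close>

definition Euclid5 :: point_fm where
  "Euclid5 =
    (let a = Var 0; p = Var 1; q = Var 2; r = Var 3; s = Var 4; t = Var 5 in
     E p t q t \<^bold>\<and> B p t q \<^bold>\<and> E s t r t \<^bold>\<and> B s t r \<^bold>\<and> E p r q s \<^bold>\<and> B q a r \<^bold>\<and> p \<^bold># a \<^bold>\<and> s \<^bold># q \<^bold>\<longrightarrow>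
       Ex (let e = Var 0 in B (p\<up>1) (a\<up>1) e \<^bold>\<and> B (s\<up>1) (q\<up>1) e))"

definition EG_axioms :: "point_fm set" where
  "EG_axioms = closure ` (congruence_axioms \<union> betweenness_axioms \<union> extension_axioms \<union>
     {five_segment, inner_Pasch, outer_Pasch} \<union> lower_dimension_axioms \<union>
     line_circle_axioms \<union> {circle_circle, Euclid5})"

definition geometric_Markov :: point_fm where
  "geometric_Markov = (let a = Var 2; b = Var 1; c = Var 0 in
     All (All (All (\<^bold>\<not> \<^bold>\<not> B a b c \<^bold>\<longrightarrow> B a b c))))"

end

theory Submission
  imports "HOL-Analysis.Path_Connected" "HOL-Analysis.Continuum_Not_Denumerable" Defs
begin

text \<open>
  Both parts use a Kripke model with two worlds, the same domain at both, and two Euclidean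
  subfields \<open>K\<close> of the reals: a countable one at the root, all of \<open>\<real>\<close> at the top. In the field
  model the domain is \<open>\<real>\<close> and \<open>P(x)\<close> means that \<open>x\<close> is a positive element of \<open>K\<close>. In the plane
  model the domain is the complex plane, congruence is true congruence, and \<open>B(a,b,c)\<close> means that
  \<open>b\<close> lies strictly between \<open>a\<close> and \<open>c\<close> with both distances in \<open>K\<close>.

  Negated statements are decided at the top, so \<open>T\<close> is ordinary non-strict betweenness at both
  worlds, whereas \<open>a # b\<close> says that the distance of the distinct points \<open>a\<close> and \<open>b\<close> lies in \<open>K\<close>. An
  angle that is provably between \<open>0\<close> and \<open>\<pi>\<close> has its cosine in \<open>K\<close>, so all the points in a Pasch
  configuration have coordinates in \<open>K\<close> with respect to two independent vectors whose Gram matrix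
  and lengths lie in \<open>K\<close>. A positive real outside the countable field refutes Markov's principle
  at the root.
\<close>

section \<open>Kripke models with constant domain\<close>

primrec eval :: "('f \<Rightarrow> 'a list \<Rightarrow> 'a) \<Rightarrow> (nat \<Rightarrow> 'a) \<Rightarrow> 'f tm \<Rightarrow> 'a" where
  "eval F e (Var i) = e i"
| "eval F e (Fn f ts) = F f (map (eval F e) ts)"

text \<open>The domain is the same at both worlds, so a universal formula is tested only at the
  current world; persistence (\<open>forces_mono\<close>) carries its instances to later
  worlds.\<close>

primrec forces ::
  "('f \<Rightarrow> 'a list \<Rightarrow> 'a) \<Rightarrow> ('w::preorder \<Rightarrow> 'p \<Rightarrow> 'a list \<Rightarrow> bool) \<Rightarrow> 'w \<Rightarrow> (nat \<Rightarrow> 'a) \<Rightarrow> ('f, 'p) fm \<Rightarrow> bool"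
where
  "forces F I w e Falsum = False"
| "forces F I w e (Rel p ts) = I w p (map (eval F e) ts)"
| "forces F I w e (s \<^bold>= t) = (eval F e s = eval F e t)"
| "forces F I w e (\<phi> \<^bold>\<and> \<psi>) = (forces F I w e \<phi> \<and> forces F I w e \<psi>)"
| "forces F I w e (\<phi> \<^bold>\<or> \<psi>) = (forces F I w e \<phi> \<or> forces F I w e \<psi>)"
| "forces F I w e (\<phi> \<^bold>\<longrightarrow> \<psi>) = (\<forall>v\<ge>w. forces F I v e \<phi> \<longrightarrow> forces F I v e \<psi>)"
| "forces F I w e (All \<phi>) = (\<forall>x. forces F I w (case_nat x e) \<phi>)"
| "forces F I w e (Ex \<phi>) = (\<exists>x. forces F I w (case_nat x e) \<phi>)"

section \<open>Substitution and environments\<close>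

lemma eval_subst_tm: "eval F e (subst_tm \<sigma> t) = eval F (\<lambda>i. eval F e (\<sigma> i)) t"
  by (induction t) (auto cong: map_cong simp: comp_def)

lemma eval_shift [simp]: "eval F e (t \<up> n) = eval F (\<lambda>i. e (i + n)) t"
  by (simp add: shift_def eval_subst_tm)

text \<open>Abbreviations such as \<open>apart\<close> shift their arguments before entering
  quantifiers; these rules cancel the shift against the environment extended at each
  quantifier.\<close>

lemma case_nat_shift [simp]:
  "(\<lambda>i. case_nat x e (i + numeral k)) = (\<lambda>i. e (i + pred_numeral k))"
  "(\<lambda>i. case_nat x e (Suc i)) = e"
  by (simp_all add: numeral_eq_Suc)

lemma eval_under_binder:
  "(\<lambda>i. eval F (case_nat x e) (case i of 0 \<Rightarrow> Var 0 | Suc j \<Rightarrow> \<sigma> j \<up> 1))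
    = case_nat x (\<lambda>i. eval F e (\<sigma> i))"
  by (auto split: nat.split)

lemma forces_subst_fm:
  "forces F I w e (subst_fm \<sigma> \<phi>) = forces F I w (\<lambda>i. eval F e (\<sigma> i)) \<phi>"
  by (induction \<phi> arbitrary: \<sigma> w e) (simp_all add: eval_subst_tm eval_under_binder comp_def del: One_nat_def)

lemma forces_lift_fm [simp]: "forces F I w (case_nat x e) (lift_fm \<phi>) = forces F I w e \<phi>"
  by (simp add: lift_fm_def forces_subst_fm)

lemma forces_inst [simp]: "forces F I w e (inst t \<phi>) = forces F I w (case_nat (eval F e t) e) \<phi>"
proof -
  have "(\<lambda>i. eval F e (case_nat t Var i)) = case_nat (eval F e t) e"
    by (auto split: nat.split)
  then show ?thesis by (simp add: inst_def forces_subst_fm)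
qed

section \<open>Persistence and soundness\<close>

definition persistent :: "('w::preorder \<Rightarrow> 'p \<Rightarrow> 'a list \<Rightarrow> bool) \<Rightarrow> bool" where
  "persistent I \<longleftrightarrow> (\<forall>v w p xs. v \<le> w \<longrightarrow> I v p xs \<longrightarrow> I w p xs)"

lemma forces_mono:
  assumes "persistent I" "v \<le> w" "forces F I v e \<phi>"
  shows "forces F I w e \<phi>"
  using assms(2,3)
proof (induction \<phi> arbitrary: v w e)
  case (Rel p ts)
  then show ?case using assms(1) by (simp add: persistent_def)
next
  case (Imp \<phi> \<psi>)
  then show ?case by (auto intro: order_trans)
qed auto

text \<open>The induction treats all worlds and environments at once, because \<open>ImpI\<close>
  passes to later worlds and the eigenvariable rules extend the environment.\<close>

theorem soundness:
  assumes "persistent I" "deriv af ap \<Gamma> \<phi>" "\<forall>\<gamma>\<in>\<Gamma>. forces F I w e \<gamma>"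
  shows "forces F I w e \<phi>"
  using assms(2,3)
proof (induction arbitrary: w e rule: deriv.induct)
  case (DisjE \<Gamma> \<phi> \<psi> \<chi>)
  then have "forces F I w e \<phi> \<or> forces F I w e \<psi>"
    by simp
  then show ?case
    using DisjE.IH(2,3) DisjE.prems by (metis insert_iff)
next
  case (ImpI \<phi> \<Gamma> \<psi>)
  then show ?case by simp (meson forces_mono[OF assms(1)])
next
  case (ExE \<Gamma> \<phi> \<psi>)
  then obtain x where x: "forces F I w (case_nat x e) \<phi>"
    by (metis forces.simps(8))
  have "forces F I w (case_nat x e) (lift_fm \<psi>)"
    by (rule ExE.IH(2)) (use x ExE.prems in simp)
  then show ?case by simp
next
  case (EqE \<phi> \<Gamma> s t)
  then show ?case by simp
qed auto

lemma forces_closure: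
  assumes "\<And>\<phi> e. \<phi> \<in> S \<Longrightarrow> forces F I w e \<phi>" "\<psi> \<in> closure ` S"
  shows "forces F I w e \<psi>"
proof -
  obtain \<phi> where \<phi>: "\<phi> \<in> S" "\<psi> = (All ^^ bound_fm \<phi>) \<phi>"
    using assms(2) by (auto simp: closure_def)
  have "\<forall>e. forces F I w e ((All ^^ n) \<phi>)" for n
    by (induction n) (use assms(1) \<phi>(1) in simp_all)
  with \<phi>(2) show ?thesis by simp
qed

text \<open>In the frame \<open>bool\<close> the root is \<open>False\<close> and the top is \<open>True\<close>.\<close>

lemma forces_Neg [simp]:
  fixes w :: bool
  assumes "persistent I"
  shows "forces F I w e (\<^bold>\<not> \<phi>) \<longleftrightarrow> \<not> forces F I True e \<phi>"
  using forces_mono[OF assms, of _ True] by auto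

lemma forces_ImpI:
  "(\<And>v. w \<le> v \<Longrightarrow> forces F I v e \<phi> \<Longrightarrow> forces F I v e \<psi>) \<Longrightarrow> forces F I w e (\<phi> \<^bold>\<longrightarrow> \<psi>)"
  by simp

text \<open>Otherwise negations would be unfolded before \<open>forces_Neg\<close> applies to them.\<close>

declare forces.simps(6) [simp del]

section \<open>Euclidean subfields of the reals\<close>

text \<open>The closure conditions are total thanks to the conventions \<open>inverse 0 = 0\<close>
  and \<open>sqrt (- x) = - sqrt x\<close>.\<close>

locale euclidean_subfield =
  fixes K :: "real set"
  assumes one [simp]: "1 \<in> K"
    and diff [simp]: "x \<in> K \<Longrightarrow> y \<in> K \<Longrightarrow> x - y \<in> K"
    and mult [simp]: "x \<in> K \<Longrightarrow> y \<in> K \<Longrightarrow> x * y \<in> K"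
    and inverse [simp]: "x \<in> K \<Longrightarrow> inverse x \<in> K"
    and sqrt [simp]: "x \<in> K \<Longrightarrow> sqrt x \<in> K"
begin

lemma zero [simp]: "0 \<in> K"
  using diff[OF one one] by simp

lemma uminus [simp]: "x \<in> K \<Longrightarrow> - x \<in> K"
  using diff[OF zero] by simp

lemma plus [simp]: "x \<in> K \<Longrightarrow> y \<in> K \<Longrightarrow> x + y \<in> K"
  using diff[of x "- y"] by simp

lemma divide [simp]: "x \<in> K \<Longrightarrow> y \<in> K \<Longrightarrow> x / y \<in> K"
  by (simp add: divide_inverse)

lemma power [simp]: "x \<in> K \<Longrightarrow> x ^ n \<in> K"
  by (induction n) simp_all

lemma of_nat [simp]: "real n \<in> K"
  by (induction n) simp_all

lemma numeral [simp]: "numeral k \<in> K"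
  using of_nat[of "numeral k"] by simp

lemma of_square: "x\<^sup>2 \<in> K \<Longrightarrow> 0 \<le> x \<Longrightarrow> x \<in> K"
  using sqrt[of "x\<^sup>2"] by simp

end

text \<open>Names for the reals generated from 1 by field operations and square roots. There are
  countably many names, so their values form a countable Euclidean subfield.\<close>

datatype expr = EOne | EDiff expr expr | EMult expr expr | EInverse expr | ESqrt expr

instance expr :: countable
  by countable_datatype

primrec expr_val :: "expr \<Rightarrow> real" where
  "expr_val EOne = 1"
| "expr_val (EDiff s t) = expr_val s - expr_val t"
| "expr_val (EMult s t) = expr_val s * expr_val t"
| "expr_val (EInverse s) = inverse (expr_val s)"
| "expr_val (ESqrt s) = sqrt (expr_val s)"

definition constructible :: "real set" where
  "constructible = range expr_val"

lemma euclidean_subfield_constructible: "euclidean_subfield constructible"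
  unfolding constructible_def
  by unfold_locales (auto simp flip: expr_val.simps)

lemma euclidean_subfield_UNIV: "euclidean_subfield UNIV"
  by unfold_locales auto

text \<open>A countable set misses some real. It is nonzero since 0 is constructible, and its sign
  may be changed since the subfield is closed under negation.\<close>

lemma positive_not_constructible: "\<exists>x>0. x \<notin> constructible"
proof -
  have "countable constructible"
    by (simp add: constructible_def)
  then obtain x where x: "x \<notin> constructible"
    using uncountable_UNIV_real by (metis UNIV_eq_I)
  interpret euclidean_subfield constructible
    by (rule euclidean_subfield_constructible)
  show ?thesis
    using x zero uminus[of "- x"] by (metis minus_minus neg_0_less_iff_less linorder_neqE_linordered_idom)
qed

definition numbers_at :: "bool \<Rightarrow> real set" where
  "numbers_at w = (if w then UNIV else constructible)"

lemma numbers_at_mono: "v \<le> w \<Longrightarrow> numbers_at v \<subseteq> numbers_at w"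
  by (auto simp: numbers_at_def)

lemma numbers_at_simps [simp]: "numbers_at True = UNIV" "numbers_at False = constructible"
  by (simp_all add: numbers_at_def)

lemma euclidean_subfield_numbers_at: "euclidean_subfield (numbers_at w)"
  by (simp add: numbers_at_def euclidean_subfield_constructible euclidean_subfield_UNIV)

section \<open>The field model\<close>

primrec field_op :: "field_fun \<Rightarrow> real list \<Rightarrow> real" where
  "field_op Zero xs = 0"
| "field_op One xs = 1"
| "field_op Plus xs = xs ! 0 + xs ! 1"
| "field_op Minus xs = - (xs ! 0)"
| "field_op Times xs = xs ! 0 * xs ! 1"

primrec field_holds :: "bool \<Rightarrow> field_rel \<Rightarrow> real list \<Rightarrow> bool" where
  "field_holds w Positive xs \<longleftrightarrow> 0 < xs ! 0 \<and> xs ! 0 \<in> numbers_at w"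

lemma persistent_field_holds [simp]: "persistent field_holds"
  unfolding persistent_def
proof (intro allI impI)
  show "field_holds w p xs" if "v \<le> w" "field_holds v p xs" for v w p xs
    using that numbers_at_mono[of v w] by (cases p) auto
qed

abbreviation "field_forces \<equiv> forces field_op field_holds"

lemma field_forces_axioms:
  assumes "\<phi> \<in> weakly_Euclidean_field_axioms"
  shows "field_forces w e \<phi>"
proof -
  interpret K: euclidean_subfield "numbers_at v" for v
    by (rule euclidean_subfield_numbers_at)
  have inv: "\<exists>y. x * y = 1 \<and> 0 < y \<and> y \<in> numbers_at v" if "0 < x" "x \<in> numbers_at v" for x v
    using that by (intro exI[of _ "inverse x"]) simp
  \<comment> \<open>In the square root axiom the negated hypothesis is decided at the top, where it
    says that y is not positive. The root may be any real, constructible or not.\<close>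
  have root: "\<exists>z. z * z = x" if "x + y = 0" "\<not> 0 < y" for x y :: real
    using that by (intro exI[of _ "sqrt x"]) simp
  have ring: "\<phi> \<in> comm_ring_axioms \<Longrightarrow> field_forces w e \<phi>"
    unfolding comm_ring_axioms_def
    by (erule forces_closure[rotated]) (auto simp: Let_def algebra_simps)
  show ?thesis
    using assms ring unfolding weakly_Euclidean_field_axioms_def
    apply (elim UnE)
     apply blast
    apply (erule forces_closure[rotated])
    apply (auto simp: Let_def inv root intro!: forces_ImpI)
    done
qed

lemma field_forces_not_Markov: "\<not> field_forces False e field_Markov"
proof -
  obtain x :: real where "0 < x" "x \<notin> constructible"
    using positive_not_constructible by blast
  then show ?thesis
    \<comment> \<open>The clause for implication is instantiated to negated premises, so that the
      negation of an atom is left to \<open>forces_Neg\<close>.\<close>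
    by (auto simp: field_Markov_def Let_def forces.simps(6)[of _ _ _ _ "\<^bold>\<not> \<phi>" for \<phi>] ex_bool_eq
        intro!: exI[of _ x])
qed

section \<open>Betweenness and angles over a subfield\<close>

definition btw :: "real set \<Rightarrow> 'a::real_inner \<Rightarrow> 'a \<Rightarrow> 'a \<Rightarrow> bool" where
  "btw K a b c \<longleftrightarrow> b \<in> open_segment a c \<and> dist a b \<in> K \<and> dist b c \<in> K"

definition cosine :: "'a::real_inner \<Rightarrow> 'a \<Rightarrow> 'a \<Rightarrow> real" where
  "cosine a b c = inner (a - b) (c - b) / (norm (a - b) * norm (c - b))"

definition angle_in :: "real set \<Rightarrow> 'a::real_inner \<Rightarrow> 'a \<Rightarrow> 'a \<Rightarrow> bool" where
  "angle_in K a b c \<longleftrightarrow> a \<noteq> b \<and> c \<noteq> b \<and> dist b a \<in> K \<and> dist b c \<in> K \<and> cosine a b c \<in> K"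

section \<open>Cosines and the law of cosines\<close>

lemma cosine_commute: "cosine c b a = cosine a b c"
  by (simp add: cosine_def inner_commute mult.commute)

lemma cosine_ray:
  assumes "u - b = s *\<^sub>R (a - b)" "0 < s"
  shows "cosine u b c = cosine a b c"
  using assms by (simp add: cosine_def)

lemma cosine_opposite:
  assumes "d - b = s *\<^sub>R (a - b)" "s < 0"
  shows "cosine d b c = - cosine a b c"
  using assms by (simp add: cosine_def)

lemma law_of_cosines:
  "2 * inner (a - b) (c - b) = (dist b a)\<^sup>2 + (dist b c)\<^sup>2 - (dist a c)\<^sup>2"
  by (simp add: dist_norm power2_norm_eq_inner inner_diff inner_commute)

lemma cosine_cong:
  assumes "dist b u = dist b' u'" "dist b v = dist b' v'" "dist u v = dist u' v'"
  shows "cosine u b v = cosine u' b' v'"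
proof -
  have "inner (u - b) (v - b) = inner (u' - b') (v' - b')"
    using law_of_cosines[of u b v] law_of_cosines[of u' b' v'] assms by simp
  then show ?thesis
    using assms by (simp add: cosine_def dist_norm norm_minus_commute)
qed

text \<open>In this isosceles triangle the law of cosines makes the inner product fall short of the
  squared leg by half the squared base.\<close>

lemma cosine_less_one:
  assumes "u \<noteq> v" "dist b u = dist b v" "b \<noteq> u"
  shows "cosine u b v < 1"
proof -
  have "0 < (dist u v)\<^sup>2"
    using assms by simp
  then have "inner (u - b) (v - b) < (dist b u)\<^sup>2"
    using law_of_cosines[of u b v] unfolding assms(2)[symmetric] by linarith
  moreover have "cosine u b v = inner (u - b) (v - b) / (dist b u)\<^sup>2"
    using assms(2) by (simp add: cosine_def dist_norm norm_minus_commute power2_eq_square)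
  moreover have "0 < (dist b u)\<^sup>2"
    using assms(3) by simp
  ultimately show ?thesis
    by (simp del: zero_less_power2)
qed

text \<open>Stewart's theorem, valid for every real parameter and hence also beyond the
  endpoints.\<close>

lemma norm_add_scaleR_square:
  fixes a b :: "'a::real_inner"
  shows "(norm ((1 - t) *\<^sub>R a + t *\<^sub>R b))\<^sup>2
    = (1 - t) * (norm a)\<^sup>2 + t * (norm b)\<^sup>2 - t * (1 - t) * (norm (a - b))\<^sup>2"
  by (simp add: power2_norm_eq_inner inner_add inner_diff inner_commute algebra_simps)

text \<open>Expresses the far endpoint through the two nearer points with ratios of distances as
  coefficients, so congruent segments give equal coefficients.\<close>

lemma in_closed_segment_beyond:
  fixes a b c :: "'a::real_inner"
  assumes "a \<noteq> b" "b \<in> closed_segment a c"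
  shows "c = a + (dist a c / dist a b) *\<^sub>R (b - a)" "dist a c = dist a b + dist b c"
    "c - b = (dist b c / dist a b) *\<^sub>R (b - a)"
proof -
  obtain u where u: "0 \<le> u" "u \<le> 1" "b = a + u *\<^sub>R (c - a)"
    using assms(2) by (auto simp: in_segment algebra_simps)
  with assms(1) have "u \<noteq> 0" by auto
  have ab: "dist a b = u * dist a c"
    using u by (simp add: dist_norm norm_minus_commute)
  have "b - c = (1 - u) *\<^sub>R (a - c)"
    using u(3) by (simp add: algebra_simps)
  then have bc: "dist b c = (1 - u) * dist a c"
    using u by (simp add: dist_norm)
  have "c \<noteq> a" using assms u by auto
  have ba: "b - a = u *\<^sub>R (c - a)" and "c - b = (1 - u) *\<^sub>R (c - a)"
    using u(3) by (simp_all add: algebra_simps)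
  then show "c - b = (dist b c / dist a b) *\<^sub>R (b - a)"
    using \<open>u \<noteq> 0\<close> \<open>c \<noteq> a\<close> by (simp add: ab bc)
  show "c = a + (dist a c / dist a b) *\<^sub>R (b - a)"
    using \<open>u \<noteq> 0\<close> \<open>c \<noteq> a\<close> by (simp add: ab ba)
  show "dist a c = dist a b + dist b c"
    by (simp add: ab bc algebra_simps)
qed

text \<open>Both c and c' are affine combinations with the same coefficient t, so Stewart's theorem
  computes both distances from the same data.\<close>

lemma five_segment_inner_space:
  fixes a b c d a' b' c' d' :: "'a::real_inner"
  assumes "a \<noteq> b" "b \<in> closed_segment a c" "b' \<in> closed_segment a' c'"
    and "dist a b = dist a' b'" "dist b c = dist b' c'" "dist a d = dist a' d'" "dist b d = dist b' d'"
  shows "dist c d = dist c' d'"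
proof -
  define t where "t = dist a c / dist a b"
  have "a' \<noteq> b'" using assms(1,4) by auto
  note 1 = in_closed_segment_beyond[OF assms(1,2)]
  note 2 = in_closed_segment_beyond[OF \<open>a' \<noteq> b'\<close> assms(3)]
  have t': "t = dist a' c' / dist a' b'"
    using 1(2) 2(2) assms by (simp add: t_def)
  have "c - d = (1 - t) *\<^sub>R (a - d) + t *\<^sub>R (b - d)"
    using 1(1) unfolding t_def[symmetric] by (simp add: algebra_simps)
  moreover have "c' - d' = (1 - t) *\<^sub>R (a' - d') + t *\<^sub>R (b' - d')"
    using 2(1) unfolding t'[symmetric] by (simp add: algebra_simps)
  ultimately have "(norm (c - d))\<^sup>2 = (norm (c' - d'))\<^sup>2"
    using assms by (simp add: norm_add_scaleR_square dist_norm)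
  then show ?thesis by (simp add: dist_norm)
qed

lemma open_segment_midpoint:
  fixes p q t :: "'a::real_inner"
  assumes "t \<in> open_segment p q" "dist p t = dist q t"
  shows "p + q = 2 *\<^sub>R t"
proof -
  obtain u where u: "0 < u" "u < 1" "t = (1 - u) *\<^sub>R p + u *\<^sub>R q" and "p \<noteq> q"
    using assms(1) by (auto simp: in_segment)
  have "p - t = u *\<^sub>R (p - q)" "q - t = (1 - u) *\<^sub>R (q - p)"
    using u(3) by (simp_all add: algebra_simps)
  then have "u * norm (p - q) = (1 - u) * norm (p - q)"
    using assms(2) u by (simp add: dist_norm norm_minus_commute)
  then have "u = 1 / 2" using \<open>p \<noteq> q\<close> by simp
  with u(3) show ?thesis by (simp add: algebra_simps flip: scaleR_add_left)
qed

text \<open>Intermediate values: a sphere is connected in dimension at least 2, and the distance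
  from c' is continuous on it.\<close>

lemma circle_circle_euclidean:
  fixes a b c c' :: "'a::euclidean_space"
  assumes "2 \<le> DIM('a)" "dist c a = \<rho>" "dist c b = \<rho>" "dist c' a \<le> \<rho>'" "\<rho>' \<le> dist c' b"
  shows "\<exists>e. dist c e = \<rho> \<and> dist c' e = \<rho>'"
proof -
  have "connected (dist c' ` sphere c \<rho>)"
    by (intro connected_continuous_image continuous_intros connected_sphere assms(1))
  moreover have "dist c' a \<in> dist c' ` sphere c \<rho>" "dist c' b \<in> dist c' ` sphere c \<rho>"
    using assms(2,3) by auto
  ultimately have "\<rho>' \<in> dist c' ` sphere c \<rho>"
    using assms(4,5) by (rule connectedD_interval)
  then show ?thesis by auto
qed

definition proper_in :: "real set \<Rightarrow> 'a::real_inner \<Rightarrow> 'a \<Rightarrow> 'a \<Rightarrow> bool" where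
  "proper_in K a b c \<longleftrightarrow> angle_in K a b c \<and> \<bar>cosine a b c\<bar> < 1"

text \<open>Positivity of the Gram determinant says that the two vectors are linearly independent.\<close>

definition frame_in :: "real set \<Rightarrow> 'a::real_inner \<Rightarrow> 'a \<Rightarrow> bool" where
  "frame_in K x y \<longleftrightarrow> norm x \<in> K \<and> norm y \<in> K \<and> inner x y \<in> K \<and> (inner x y)\<^sup>2 < inner x x * inner y y"

section \<open>Order properties of betweenness and extension of segments\<close>

lemma btw_commute: "btw K a b c \<longleftrightarrow> btw K c b a"
  by (auto simp: btw_def open_segment_commute dist_commute)

lemma not_btw_refl: "\<not> btw K a b a"
  by (simp add: btw_def)

lemma btw_inner_trans:
  assumes "btw K a b d" "btw K b c d"
  shows "btw K a b c"
proof -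
  obtain u v where u: "0 < u" "u < 1" "b = (1 - u) *\<^sub>R a + u *\<^sub>R d" and "a \<noteq> d"
    and v: "0 < v" "v < 1" "c = (1 - v) *\<^sub>R b + v *\<^sub>R d"
    using assms by (auto simp: in_segment btw_def)
  \<comment> \<open>The parameter of c on the segment from a to d; then b has parameter u / w on the
    segment from a to c.\<close>
  define w where "w = u + v - u * v"
  have "w - u = v * (1 - u)"
    by (simp add: w_def algebra_simps)
  then have "0 < w - u"
    using u(2) v(1) by simp
  with u(1) have w: "u < w" "0 < w"
    by simp_all
  have b: "b = a + u *\<^sub>R (d - a)"
    using u(3) by (simp add: algebra_simps)
  have c: "c = a + w *\<^sub>R (d - a)"
    unfolding v(3) unfolding b w_def by (simp add: algebra_simps)
  have "c \<noteq> a" using c w \<open>a \<noteq> d\<close> by simp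
  moreover have "b = (1 - u / w) *\<^sub>R a + (u / w) *\<^sub>R c"
    using w unfolding b c by (simp add: algebra_simps)
  ultimately have "b \<in> open_segment a c"
    using u w by (auto simp: in_segment intro!: exI[of _ "u / w"])
  then show ?thesis using assms by (simp add: btw_def)
qed

lemma open_segment_connectivity:
  fixes a b c d :: "'a::real_inner"
  assumes "b \<in> open_segment a d" "c \<in> open_segment a d" "b \<notin> open_segment a c" "c \<notin> open_segment a b"
  shows "b = c"
proof -
  obtain u v where u: "0 < u" "b = a + u *\<^sub>R (d - a)" and v: "0 < v" "c = a + v *\<^sub>R (d - a)"
    and "a \<noteq> d"
    using assms(1,2) by (auto simp: in_segment algebra_simps)
  have 1: "a + u *\<^sub>R (d - a) \<in> open_segment a (a + v *\<^sub>R (d - a))" if "0 < u" "u < v" for u v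
  proof -
    have "a + u *\<^sub>R (d - a) = (1 - u / v) *\<^sub>R a + (u / v) *\<^sub>R (a + v *\<^sub>R (d - a))"
      using that by (simp add: algebra_simps)
    then show ?thesis
      using that \<open>a \<noteq> d\<close> unfolding in_segment by (intro conjI exI[of _ "u / v"]) simp_all
  qed
  show ?thesis
    using 1[of u v] 1[of v u] u v assms(3,4) by (cases u v rule: linorder_cases) auto
qed

context euclidean_subfield
begin

text \<open>Trades the two lengths for one length and one parameter in K; the Pasch and parallel
  axioms are verified by computing such parameters.\<close>

lemma btw_iff:
  fixes a b c :: "'a::real_inner"
  shows "btw K a b c \<longleftrightarrow>
    a \<noteq> c \<and> dist a c \<in> K \<and> (\<exists>t\<in>K. 0 < t \<and> t < 1 \<and> b = a + t *\<^sub>R (c - a))" (is "?l \<longleftrightarrow> ?r")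
proof
  assume l: ?l
  then have "b \<in> closed_segment a c" "a \<noteq> b"
    by (auto simp: btw_def open_segment_def)
  from in_closed_segment_beyond(2)[OF this(2,1)] l have "dist a c \<in> K"
    by (simp add: btw_def)
  moreover obtain t where t: "0 < t" "t < 1" "b = a + t *\<^sub>R (c - a)" and "a \<noteq> c"
    using l by (auto simp: btw_def in_segment algebra_simps)
  have "dist a b = t * dist a c"
    using t by (simp add: dist_norm norm_minus_commute)
  then have "t = dist a b / dist a c" using \<open>a \<noteq> c\<close> by simp
  then have "t \<in> K" using l \<open>dist a c \<in> K\<close> by (simp add: btw_def)
  ultimately show ?r using t \<open>a \<noteq> c\<close> by blast
next
  assume ?r
  then obtain t where t: "t \<in> K" "0 < t" "t < 1" "b = a + t *\<^sub>R (c - a)" "a \<noteq> c" "dist a c \<in> K"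
    by blast
  have "dist a b = t * dist a c"
    using t by (simp add: dist_norm norm_minus_commute)
  moreover have "b - c = (1 - t) *\<^sub>R (a - c)"
    using t(4) by (simp add: algebra_simps)
  then have "dist b c = (1 - t) * dist a c"
    using t by (simp add: dist_norm)
  moreover have "b \<in> open_segment a c"
    using t by (auto simp: in_segment algebra_simps intro!: exI[of _ t])
  ultimately show ?l using t by (simp add: btw_def)
qed

lemma btw_beyond:
  fixes a b c :: "'a::real_inner"
  assumes "a \<noteq> b" "dist a b \<in> K" "t \<in> K" "1 < t" "c = a + t *\<^sub>R (b - a)"
  shows "btw K a b c"
proof -
  have ac: "dist a c = t * dist a b"
    using assms by (simp add: dist_norm norm_minus_commute)
  have "0 < dist a c"
    unfolding ac using assms(1,4) by simp
  then have "a \<noteq> c" by auto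
  moreover have "dist a c \<in> K"
    unfolding ac using assms by simp
  moreover have "b = a + (1 / t) *\<^sub>R (c - a)"
    using assms by simp
  moreover have "1 / t \<in> K" "0 < 1 / t" "1 / t < 1"
    using assms(3,4) by simp_all
  ultimately show ?thesis
    unfolding btw_iff by blast
qed

lemma btw_extension:
  fixes a b c d :: "'a::real_inner"
  assumes "a \<noteq> b" "dist a b \<in> K" "c \<noteq> d" "dist c d \<in> K"
  shows "\<exists>e. btw K a b e \<and> dist b e = dist c d"
proof (intro exI conjI)
  \<comment> \<open>The factor that lengthens ab by the length of cd.\<close>
  let ?t = "1 + dist c d / dist a b"
  let ?e = "a + ?t *\<^sub>R (b - a)"
  show "btw K a b ?e"
    by (rule btw_beyond[of _ _ ?t]) (use assms in simp_all)
  have "b - ?e = - (dist c d / dist a b) *\<^sub>R (b - a)"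
    by (simp add: algebra_simps)
  then show "dist b ?e = dist c d"
    using assms by (simp add: dist_norm norm_minus_commute)
qed

lemma btwD:
  fixes a b c :: "'a::real_inner"
  assumes "btw K a b c"
  shows "a \<noteq> b" "b \<noteq> c" "a \<noteq> c" "dist a b \<in> K" "dist b c \<in> K" "dist a c \<in> K"
proof -
  show "a \<noteq> c" "dist a c \<in> K"
    using assms btw_iff by blast+
qed (use assms in \<open>auto simp: btw_def open_segment_def\<close>)

lemma apart_iff_btw:
  fixes a b :: "'a::real_inner"
  shows "(\<exists>e. btw K e a b \<or> btw K a e b \<or> btw K a b e) \<longleftrightarrow> a \<noteq> b \<and> dist a b \<in> K"
proof
  assume "\<exists>e. btw K e a b \<or> btw K a e b \<or> btw K a b e"
  then obtain e where "btw K e a b \<or> btw K a e b \<or> btw K a b e" ..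
  then show "a \<noteq> b \<and> dist a b \<in> K"
    by (elim disjE) (simp_all add: btwD)
next
  assume "a \<noteq> b \<and> dist a b \<in> K"
  then show "\<exists>e. btw K e a b \<or> btw K a e b \<or> btw K a b e"
    using btw_extension[of a b a b] by blast
qed

end

text \<open>The Gram determinant is multiplied by the square of the determinant of the change of
  coordinates.\<close>

lemma gram_combination:
  fixes x y :: "'a::real_inner"
  shows "inner (s *\<^sub>R x + t *\<^sub>R y) (s *\<^sub>R x + t *\<^sub>R y) * inner (u *\<^sub>R x + v *\<^sub>R y) (u *\<^sub>R x + v *\<^sub>R y)
      - (inner (s *\<^sub>R x + t *\<^sub>R y) (u *\<^sub>R x + v *\<^sub>R y))\<^sup>2
    = (s * v - t * u)\<^sup>2 * (inner x x * inner y y - (inner x y)\<^sup>2)"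
  by (simp add: inner_add inner_commute[of y x] power2_eq_square algebra_simps)

context euclidean_subfield
begin

lemma norm_in_frame:
  fixes x y :: "'a::real_inner"
  assumes "frame_in K x y" "s \<in> K" "t \<in> K"
  shows "norm (s *\<^sub>R x + t *\<^sub>R y) \<in> K"
proof (rule of_square)
  have "(norm (s *\<^sub>R x + t *\<^sub>R y))\<^sup>2 = s\<^sup>2 * (norm x)\<^sup>2 + 2 * s * t * inner x y + t\<^sup>2 * (norm y)\<^sup>2"
    unfolding power2_norm_eq_inner
    by (simp add: inner_add inner_commute[of y x] power2_eq_square algebra_simps)
  then show "(norm (s *\<^sub>R x + t *\<^sub>R y))\<^sup>2 \<in> K"
    using assms by (simp add: frame_in_def)
qed simp

lemma nonzero_in_frame:
  fixes x y :: "'a::real_inner"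
  assumes "frame_in K x y" "s \<noteq> 0 \<or> t \<noteq> 0"
  shows "s *\<^sub>R x + t *\<^sub>R y \<noteq> 0"
proof
  assume 0: "s *\<^sub>R x + t *\<^sub>R y = 0"
  \<comment> \<open>Pairing with coordinates (t, -s) gives the coordinate determinant -(s^2 + t^2),
    while the Gram determinant vanishes with the first vector.\<close>
  have "(s * - s - t * t)\<^sup>2 * (inner x x * inner y y - (inner x y)\<^sup>2) = 0"
    using gram_combination[of s x t y t "- s"] unfolding 0 by simp
  then have "s * - s - t * t = 0"
    using assms(1) by (auto simp: frame_in_def)
  then have "s * s + t * t = 0"
    by linarith
  with assms(2) show False
    unfolding sum_squares_eq_zero_iff by blast
qed

text \<open>Serves the Pasch axioms when the given angle has a different vertex from the origin of
  coordinates.\<close>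

lemma change_of_frame:
  fixes x y :: "'a::real_inner"
  assumes "frame_in K x y" "s \<in> K" "t \<in> K" "u \<in> K" "v \<in> K" "s * v \<noteq> t * u"
  shows "frame_in K (s *\<^sub>R x + t *\<^sub>R y) (u *\<^sub>R x + v *\<^sub>R y)"
proof -
  have "0 < (s * v - t * u)\<^sup>2 * (inner x x * inner y y - (inner x y)\<^sup>2)"
    using assms by (simp add: frame_in_def)
  moreover have "inner (s *\<^sub>R x + t *\<^sub>R y) (u *\<^sub>R x + v *\<^sub>R y)
      = s * u * (norm x)\<^sup>2 + (s * v + t * u) * inner x y + t * v * (norm y)\<^sup>2"
    by (simp add: power2_norm_eq_inner inner_add inner_commute[of y x] algebra_simps)
  then have "inner (s *\<^sub>R x + t *\<^sub>R y) (u *\<^sub>R x + v *\<^sub>R y) \<in> K"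
    using assms by (simp add: frame_in_def)
  moreover have "norm (s *\<^sub>R x + t *\<^sub>R y) \<in> K" "norm (u *\<^sub>R x + v *\<^sub>R y) \<in> K"
    using assms by (simp_all add: norm_in_frame)
  ultimately show ?thesis
    unfolding frame_in_def gram_combination[symmetric] by simp
qed

text \<open>The inner product is the cosine times two lengths in K, and a cosine strictly between -1
  and 1 makes the Cauchy-Schwarz inequality strict.\<close>

lemma proper_in_frame:
  fixes a b c :: "'a::real_inner"
  assumes "proper_in K a b c"
  shows "frame_in K (a - b) (c - b)"
proof -
  let ?k = "cosine a b c"
  have nz: "norm (a - b) \<noteq> 0" "norm (c - b) \<noteq> 0"
    and K: "norm (a - b) \<in> K" "norm (c - b) \<in> K" "?k \<in> K"
    using assms by (auto simp: proper_in_def angle_in_def dist_norm norm_minus_commute)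
  have eq: "inner (a - b) (c - b) = ?k * (norm (a - b) * norm (c - b))"
    using nz by (simp add: cosine_def)
  have "?k\<^sup>2 < 1"
    using assms by (simp add: proper_in_def abs_square_less_1)
  moreover have "0 < (norm (a - b) * norm (c - b))\<^sup>2"
    using nz by simp
  ultimately have "(?k * (norm (a - b) * norm (c - b)))\<^sup>2 < (norm (a - b) * norm (c - b))\<^sup>2"
    by (simp only: power_mult_distrib[of ?k] mult_less_cancel_right2) simp
  then have "(inner (a - b) (c - b))\<^sup>2 < inner (a - b) (a - b) * inner (c - b) (c - b)"
    unfolding eq by (simp add: power_mult_distrib power2_norm_eq_inner)
  then show ?thesis
    using K by (simp add: frame_in_def eq)
qed

section \<open>Pasch and parallel axioms in coordinates\<close>

lemma btw_intro:
  fixes a b c :: "'a::real_inner"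
  assumes "c - a \<noteq> 0" "norm (c - a) \<in> K" "t \<in> K" "0 < t" "t < 1" "b = a + t *\<^sub>R (c - a)"
  shows "btw K a b c"
  unfolding btw_iff using assms by (auto simp: dist_norm norm_minus_commute)

lemma inner_Pasch_frame:
  fixes a b c p q :: "'a::real_inner"
  assumes fr: "frame_in K (a - c) (b - c)"
    and s: "s \<in> K" "0 < s" "s < 1" "p = c + s *\<^sub>R (a - c)"
    and r: "r \<in> K" "0 < r" "r < 1" "q = c + r *\<^sub>R (b - c)"
  shows "\<exists>x. btw K p x b \<and> btw K a x q"
proof -
  define x y where "x = a - c" and "y = b - c"
  have fr: "frame_in K x y" using fr by (simp add: x_def y_def)
  have eqs: "a = c + x" "b = c + y" "p = c + s *\<^sub>R x" "q = c + r *\<^sub>R y"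
    using s(4) r(4) by (simp_all add: x_def y_def)
  \<comment> \<open>Equating p + l (b - p) with a + m (q - a) and comparing coefficients of x and y
    gives s (1 - l) = 1 - m and l = r m, hence m (1 - s r) = 1 - s.\<close>
  define d where "d = 1 - s * r"
  define m where "m = (1 - s) / d"
  define l where "l = r * m"
  have "s * r < s" "s * r < 1"
    using s r mult_strict_mono[of s 1 r 1] by simp_all
  then have d: "d \<in> K" "0 < d" "1 - s < d"
    using s r by (simp_all add: d_def)
  then have m: "m \<in> K" "0 < m" "m < 1"
    using s by (simp_all add: m_def)
  have l: "l \<in> K" "0 < l" "l < 1"
    using s r m mult_strict_mono[of r 1 m 1] by (simp_all add: l_def)
  have "m * d = 1 - s"
    using d by (simp add: m_def)
  then have coeff: "s * (1 - l) = 1 - m"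
    by (simp add: l_def d_def algebra_simps)
  have "(s * (1 - l)) *\<^sub>R x = (1 - m) *\<^sub>R x"
    by (simp only: coeff)
  then have meet: "p + l *\<^sub>R (b - p) = a + m *\<^sub>R (q - a)"
    unfolding eqs l_def by (simp add: algebra_simps)
  have bp: "b - p = (- s) *\<^sub>R x + 1 *\<^sub>R y" and qa: "q - a = (- 1) *\<^sub>R x + r *\<^sub>R y"
    unfolding eqs by simp_all
  have "btw K p (p + l *\<^sub>R (b - p)) b"
    by (rule btw_intro[OF _ _ l refl]; unfold bp)
      (rule nonzero_in_frame[OF fr] norm_in_frame[OF fr]; use s in simp)+
  moreover have "btw K a (a + m *\<^sub>R (q - a)) q"
    by (rule btw_intro[OF _ _ m refl]; unfold qa)
      (rule nonzero_in_frame[OF fr] norm_in_frame[OF fr]; use r in simp)+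
  ultimately show ?thesis
    using meet by metis
qed

lemma inner_Pasch_btw:
  fixes a b c p q :: "'a::real_inner"
  assumes "btw K a p c" "btw K b q c" "proper_in K a c b \<or> proper_in K q p a"
  shows "\<exists>x. btw K p x b \<and> btw K a x q"
proof -
  obtain s where s: "s \<in> K" "0 < s" "s < 1" "p = c + s *\<^sub>R (a - c)"
    using assms(1) btw_commute btw_iff by metis
  obtain r where r: "r \<in> K" "0 < r" "r < 1" "q = c + r *\<^sub>R (b - c)"
    using assms(2) btw_commute btw_iff by metis
  \<comment> \<open>An angle at p is moved to c: both sides at c are combinations of q - p and a - p
    with coefficients in K.\<close>
  have "frame_in K (a - c) (b - c)" if "proper_in K q p a"
  proof -
    have fr: "frame_in K (q - p) (a - p)"
      using that by (rule proper_in_frame)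
    have "a - p = (1 - s) *\<^sub>R (a - c)"
      using s(4) by (simp add: algebra_simps)
    then have 1: "a - c = (1 / (1 - s)) *\<^sub>R (a - p)"
      using s by simp
    have "r *\<^sub>R (b - c) = (q - p) + s *\<^sub>R (a - c)"
      using s(4) r(4) by simp
    moreover have "b - c = (1 / r) *\<^sub>R (r *\<^sub>R (b - c))"
      using r by simp
    ultimately have "b - c = (1 / r) *\<^sub>R ((q - p) + (s / (1 - s)) *\<^sub>R (a - p))"
      by (simp add: 1)
    then have 2: "b - c = (1 / r) *\<^sub>R (q - p) + (1 / r * (s / (1 - s))) *\<^sub>R (a - p)"
      by (simp add: scaleR_add_right)
    have 1: "a - c = 0 *\<^sub>R (q - p) + (1 / (1 - s)) *\<^sub>R (a - p)"
      using 1 by simp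
    show ?thesis
      unfolding 1 2 by (rule change_of_frame[OF fr]) (use s r in simp_all)
  qed
  then have "frame_in K (a - c) (b - c)"
    using assms(3) proper_in_frame by blast
  from inner_Pasch_frame[OF this s r] show ?thesis .
qed

lemma outer_Pasch_frame:
  fixes a b c p q :: "'a::real_inner"
  assumes fr: "frame_in K (a - b) (q - b)"
    and s: "s \<in> K" "0 < s" "s < 1" "p = a + s *\<^sub>R (c - a)"
    and r: "r \<in> K" "0 < r" "r < 1" "c = b + r *\<^sub>R (q - b)"
  shows "\<exists>x. btw K b p x \<and> btw K a x q"
proof -
  define x y where "x = a - b" and "y = q - b"
  have fr: "frame_in K x y" using fr by (simp add: x_def y_def)
  have eqs: "a = b + x" "q = b + y" "c = b + r *\<^sub>R y" "p = b + ((1 - s) *\<^sub>R x + (s * r) *\<^sub>R y)"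
    using s(4) r(4) by (simp_all add: x_def y_def algebra_simps)
  \<comment> \<open>A point b + l (p - b) lies on the line aq when its coordinates l (1 - s) and l s
    r add up to 1, so l = 1 / d; its parameter on aq is m = l s r.\<close>
  define d where "d = 1 - s + s * r"
  have sr: "s * r < s" "0 < s * r" using s r by simp_all
  have d: "d \<in> K" "0 < d" "d < 1" "s * r < d"
    using s r sr by (simp_all add: d_def)
  define l where "l = 1 / d"
  define m where "m = s * r / d"
  have l: "l \<in> K" "1 < l" and m: "m \<in> K" "0 < m" "m < 1"
    using d s r sr by (simp_all add: l_def m_def)
  have coeff: "l * (1 - s) = 1 - m" "l * (s * r) = m"
    using d(2) by (simp_all add: l_def m_def divide_simps) (simp add: d_def)
  have "b + l *\<^sub>R (p - b) = b + ((l * (1 - s)) *\<^sub>R x + (l * (s * r)) *\<^sub>R y)"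
    unfolding eqs by (simp add: scaleR_add_right)
  also have "\<dots> = a + m *\<^sub>R (q - a)"
    unfolding coeff eqs by (simp add: algebra_simps)
  finally have meet: "b + l *\<^sub>R (p - b) = a + m *\<^sub>R (q - a)" .
  have pb: "p - b = (1 - s) *\<^sub>R x + (s * r) *\<^sub>R y" and qa: "q - a = (- 1) *\<^sub>R x + 1 *\<^sub>R y"
    unfolding eqs by simp_all
  have "p - b \<noteq> 0" "norm (p - b) \<in> K"
    unfolding pb using nonzero_in_frame[OF fr, of "1 - s" "s * r"] norm_in_frame[OF fr, of "1 - s" "s * r"] s r
    by simp_all
  then have "btw K b p (b + l *\<^sub>R (p - b))"
    by (intro btw_beyond[OF _ _ l refl]) (auto simp: dist_norm norm_minus_commute)
  moreover have "btw K a (a + m *\<^sub>R (q - a)) q"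
    by (rule btw_intro[OF _ _ m refl]; unfold qa)
      (rule nonzero_in_frame[OF fr] norm_in_frame[OF fr]; simp)+
  ultimately show ?thesis
    using meet by metis
qed

lemma outer_Pasch_btw:
  fixes a b c p q :: "'a::real_inner"
  assumes "btw K a p c" "btw K b c q" "proper_in K b a q \<or> proper_in K a b q"
  shows "\<exists>x. btw K b p x \<and> btw K a x q"
proof -
  obtain s where s: "s \<in> K" "0 < s" "s < 1" "p = a + s *\<^sub>R (c - a)"
    using assms(1) btw_iff by metis
  obtain r where r: "r \<in> K" "0 < r" "r < 1" "c = b + r *\<^sub>R (q - b)"
    using assms(2) btw_iff by metis
  have "frame_in K (a - b) (q - b)" if "proper_in K b a q"
  proof -
    have "frame_in K (b - a) (q - a)"
      using that by (rule proper_in_frame)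
    from change_of_frame[OF this, of "- 1" 0 "- 1" 1] show ?thesis
      by simp
  qed
  then have "frame_in K (a - b) (q - b)"
    using assms(3) proper_in_frame by blast
  from outer_Pasch_frame[OF this s r] show ?thesis .
qed

lemma Euclid5_btw:
  fixes a p q r s t :: "'a::real_inner"
  assumes "dist p t = dist q t" "btw K p t q" "dist s t = dist r t" "btw K s t r"
    and "btw K q a r" "p \<noteq> a" "dist p a \<in> K" "s \<noteq> q" "dist s q \<in> K"
  shows "\<exists>e. btw K p a e \<and> btw K s q e"
proof -
  obtain m where m: "m \<in> K" "0 < m" "m < 1" "a = q + m *\<^sub>R (r - q)"
    using assms(5) btw_iff by metis
  have "p + q = 2 *\<^sub>R t" "s + r = 2 *\<^sub>R t"
    using assms(1-4) open_segment_midpoint by (auto simp: btw_def)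
  then have r: "r = p + q - s" by (simp add: algebra_simps)
  \<comment> \<open>With r = p + q - s, the coefficient of p in p + l (a - p) is 1 - l (1 - m). This
    l cancels it and leaves s + l (q - s).\<close>
  define l where "l = 1 / (1 - m)"
  have l: "l \<in> K" "1 < l" and lm: "l * (1 - m) = 1"
    using m by (simp_all add: l_def)
  have lm': "l * m = l - 1" using lm by (simp add: algebra_simps)
  have "p + l *\<^sub>R (a - p) = p + (l * (1 - m)) *\<^sub>R (q - p) + (l * m) *\<^sub>R (q - s)"
    unfolding m(4) r by (simp add: algebra_simps)
  then have meet: "p + l *\<^sub>R (a - p) = s + l *\<^sub>R (q - s)"
    unfolding lm lm' by (simp add: algebra_simps)
  have "btw K p a (p + l *\<^sub>R (a - p))" "btw K s q (s + l *\<^sub>R (q - s))"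
    using assms l by (auto intro: btw_beyond)
  then show ?thesis using meet by metis
qed

end

section \<open>The plane model\<close>

text \<open>An equilateral triangle of side 2 with the midpoints of its sides and its
  centroid.\<close>

primrec point_op :: "point_const \<Rightarrow> complex list \<Rightarrow> complex" where
  "point_op Alpha xs = 0"
| "point_op Beta xs = 2"
| "point_op Gamma xs = Complex 1 (sqrt 3)"
| "point_op C1 xs = 1"
| "point_op C2 xs = Complex (1 / 2) (sqrt 3 / 2)"
| "point_op C3 xs = Complex (3 / 2) (sqrt 3 / 2)"
| "point_op C4 xs = Complex 1 (sqrt 3 / 3)"

primrec point_holds :: "bool \<Rightarrow> point_rel \<Rightarrow> complex list \<Rightarrow> bool" where
  "point_holds w Between xs \<longleftrightarrow> btw (numbers_at w) (xs ! 0) (xs ! 1) (xs ! 2)"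
| "point_holds w Congruent xs \<longleftrightarrow> dist (xs ! 0) (xs ! 1) = dist (xs ! 2) (xs ! 3)"

lemma btw_mono: "K \<subseteq> L \<Longrightarrow> btw K a b c \<Longrightarrow> btw L a b c"
  by (auto simp: btw_def)

lemma persistent_point_holds: "persistent point_holds"
  unfolding persistent_def
proof (intro allI impI)
  show "point_holds w p xs" if "v \<le> w" "point_holds v p xs" for v w p xs
    using that btw_mono[OF numbers_at_mono[of v w]] by (cases p) auto
qed

abbreviation "point_forces \<equiv> forces point_op point_holds"

abbreviation "point_val \<equiv> eval point_op"

interpretation K: euclidean_subfield "numbers_at w" for w
  by (rule euclidean_subfield_numbers_at)

lemma point_forces_Neg [simp]: "point_forces w e (\<^bold>\<not> \<phi>) \<longleftrightarrow> \<not> point_forces True e \<phi>"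
  by (rule forces_Neg[OF persistent_point_holds])

lemma point_forces_apart [simp]:
  "point_forces w e (a \<^bold># b) \<longleftrightarrow>
    point_val e a \<noteq> point_val e b \<and> dist (point_val e a) (point_val e b) \<in> numbers_at w"
  by (simp add: apart_def Let_def flip: K.apart_iff_btw)

lemma point_forces_T [simp]:
  "point_forces w e (T a b c) \<longleftrightarrow> point_val e b \<in> closed_segment (point_val e a) (point_val e c)"
  by (auto simp: T_def closed_segment_eq_open btw_def)

text \<open>Only the lengths da and ab are forced into K. The point x satisfies ordinary
  betweenness, so its distance from a is arbitrary and may be 0.\<close>

definition ray_in :: "real set \<Rightarrow> 'a::real_inner \<Rightarrow> 'a \<Rightarrow> 'a \<Rightarrow> bool" where
  "ray_in K a b x \<longleftrightarrow> (\<exists>d. btw K d a b \<and> a \<in> closed_segment d x)"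

lemma ray_inD:
  assumes "ray_in K a b x"
  shows "a \<noteq> b" "dist a b \<in> K" "\<exists>s\<ge>0. x - a = s *\<^sub>R (b - a)"
proof -
  obtain d where d: "btw K d a b" "a \<in> closed_segment d x"
    using assms by (auto simp: ray_in_def)
  then show "a \<noteq> b" "dist a b \<in> K"
    by (auto simp: btw_def open_segment_def)
  have "d \<noteq> a" "a \<in> closed_segment d b"
    using d by (auto simp: btw_def open_segment_def)
  \<comment> \<open>Seen from d, both b and x lie at or beyond a, so b - a and x - a are nonnegative
    multiples of a - d.\<close>
  have beyond: "y - a = (dist a y / dist d a) *\<^sub>R (a - d)" if "a \<in> closed_segment d y" for y
    by (rule in_closed_segment_beyond(3)[OF \<open>d \<noteq> a\<close> that])
  have "b - a = (dist a b / dist d a) *\<^sub>R (a - d)" "x - a = (dist a x / dist d a) *\<^sub>R (a - d)"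
    using beyond d \<open>a \<in> closed_segment d b\<close> by blast+
  then have "x - a = (dist a x / dist a b) *\<^sub>R (b - a)"
    using \<open>a \<noteq> b\<close> by simp
  then show "\<exists>s\<ge>0. x - a = s *\<^sub>R (b - a)"
    by (intro exI[of _ "dist a x / dist a b"]) simp
qed

lemma cosine_rays:
  assumes "ray_in K b a u" "ray_in K b c v" "u \<noteq> b" "v \<noteq> b"
  shows "cosine a b c = cosine u b v"
proof -
  obtain s r where s: "0 \<le> s" "u - b = s *\<^sub>R (a - b)" and r: "0 \<le> r" "v - b = r *\<^sub>R (c - b)"
    using ray_inD(3)[OF assms(1)] ray_inD(3)[OF assms(2)] by blast
  with assms(3,4) have "0 < s" "0 < r"
    by (auto simp: less_le)
  then show ?thesis
    using cosine_ray s(2) r(2) by (metis cosine_commute)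
qed

lemma point_forces_Ray [simp]:
  "point_forces w e (Ray a b x) \<longleftrightarrow> ray_in (numbers_at w) (point_val e a) (point_val e b) (point_val e x)"
  by (simp add: Ray_def ray_in_def Let_def)

text \<open>The witness d is the reflection of a in b; equal distances from c to a and d make the
  inner product equal to its own negative.\<close>

lemma point_forces_R:
  assumes "point_forces w e (R a b c)"
  defines "a' \<equiv> point_val e a" and "b' \<equiv> point_val e b" and "c' \<equiv> point_val e c"
  shows "a' \<noteq> b'" "b' \<noteq> c'" "a' \<noteq> c'" "dist a' b' \<in> numbers_at w" "dist b' c' \<in> numbers_at w"
    "dist a' c' \<in> numbers_at w" "inner (a' - b') (c' - b') = 0"
proof -
  obtain d where d: "btw (numbers_at w) a' b' d" "dist a' b' = dist b' d" "dist a' c' = dist d c'"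
    and *: "a' \<noteq> b'" "b' \<noteq> c'" "a' \<noteq> c'" "dist a' b' \<in> numbers_at w" "dist b' c' \<in> numbers_at w"
      "dist a' c' \<in> numbers_at w"
    using assms(1) by (auto simp: R_def Let_def dist_commute a'_def b'_def c'_def)
  then show "a' \<noteq> b'" "b' \<noteq> c'" "a' \<noteq> c'" "dist a' b' \<in> numbers_at w" "dist b' c' \<in> numbers_at w"
    "dist a' c' \<in> numbers_at w" by blast+
  have "a' + d = 2 *\<^sub>R b'"
    using d by (intro open_segment_midpoint) (simp_all add: btw_def dist_commute)
  then have d': "d - b' = - (a' - b')"
    by (simp add: scaleR_2 algebra_simps)
  have "inner (d - b') (c' - b') = - inner (a' - b') (c' - b')"
    unfolding d' by (rule inner_minus_left)
  then show "inner (a' - b') (c' - b') = 0"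
    using law_of_cosines[of a' b' c'] law_of_cosines[of d b' c'] d(2,3)
    by (simp add: dist_commute)
qed

text \<open>With the right angle at a, the cosine at b is adjacent leg over hypotenuse, so it lies
  in K when the sides do.\<close>

lemma cosine_right_triangle:
  assumes "inner (b - a) (c - a) = 0" "a \<noteq> b" "a \<noteq> c" "b \<noteq> c"
  shows "cosine a b c = dist a b / dist b c" "cosine a b c < 1"
proof -
  have "inner (a - b) (c - b) = inner (a - b) (a - b) + inner (b - a) (a - c)"
    by (simp add: inner_diff inner_commute)
  also have "inner (b - a) (a - c) = 0"
    using assms(1) by (simp add: inner_diff)
  finally have 1: "inner (a - b) (c - b) = (dist a b)\<^sup>2"
    by (simp add: dist_norm power2_norm_eq_inner)
  then show 2: "cosine a b c = dist a b / dist b c"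
    using assms by (simp add: cosine_def dist_norm norm_minus_commute power2_eq_square)
  have "2 * (dist a b)\<^sup>2 = (dist a b)\<^sup>2 + (dist b c)\<^sup>2 - (dist a c)\<^sup>2"
    using law_of_cosines[of a b c] unfolding 1 by (simp add: dist_commute)
  moreover have "0 < (dist a c)\<^sup>2"
    using assms by simp
  ultimately have "(dist a b)\<^sup>2 < (dist b c)\<^sup>2"
    by linarith
  then have "dist a b < dist b c"
    by (rule power2_less_imp_less) simp
  then show "cosine a b c < 1"
    using assms by (simp add: 2)
qed

text \<open>Each clause yields a cosine in K: by the law of cosines for an apex, as 0 for a right
  angle, and as a ratio of sides for an angle of a right triangle. Angle congruence preserves the
  cosine even if the points chosen on the rays have lengths outside K.\<close>

lemma point_forces_pos_angle:
  assumes "point_forces w e (pos_angle a b c)"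
  defines "a' \<equiv> point_val e a" and "b' \<equiv> point_val e b" and "c' \<equiv> point_val e c"
  shows "angle_in (numbers_at w) a' b' c' \<and> cosine a' b' c' < 1"
proof -
  consider (apex) "point_forces w e (apex a b c)" | (right) "point_forces w e (R a b c)"
    | (cong) x y z where
      "point_forces w (case_nat z (case_nat y (case_nat x e)))
        (angle_cong (a \<up> 3) (b \<up> 3) (c \<up> 3) (Var 2) (Var 1) (Var 0))"
      "point_forces w (case_nat z (case_nat y (case_nat x e))) (R (Var 1) (Var 2) (Var 0)) \<or>
       point_forces w (case_nat z (case_nat y (case_nat x e))) (R (Var 1) (Var 0) (Var 2))"
    using assms(1) by (auto simp: pos_angle_def Let_def)
  then show ?thesis
  proof cases
    case apex
    then obtain u v where ray: "ray_in (numbers_at w) b' a' u" "ray_in (numbers_at w) b' c' v"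
      and eq: "dist b' u = dist b' v" and ne: "b' \<noteq> u" "u \<noteq> v"
      and K: "dist b' u \<in> numbers_at w" "dist u v \<in> numbers_at w"
      by (auto simp: apex_def Let_def a'_def b'_def c'_def)
    have "b' \<noteq> v" using eq ne by auto
    have "cosine a' b' c' = cosine u b' v"
      using cosine_rays[OF ray] ne \<open>b' \<noteq> v\<close> by auto
    moreover have "cosine u b' v < 1"
      using cosine_less_one ne eq by blast
    moreover have i: "inner (u - b') (v - b') = ((dist b' u)\<^sup>2 + (dist b' v)\<^sup>2 - (dist u v)\<^sup>2) / 2"
      using law_of_cosines[of u b' v] by simp
    have "inner (u - b') (v - b') \<in> numbers_at w"
      unfolding i using K eq by simp
    then have "cosine u b' v \<in> numbers_at w"
      using K eq by (simp add: cosine_def dist_norm norm_minus_commute)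
    ultimately show ?thesis
      using ray_inD(1,2)[OF ray(1)] ray_inD(1,2)[OF ray(2)] by (auto simp: angle_in_def)
  next
    case right
    note R = point_forces_R[OF this, folded a'_def b'_def c'_def]
    then show ?thesis
      by (auto simp: angle_in_def cosine_def dist_commute)
  next
    case cong
    have ex: "\<exists>u v u' v'. ray_in (numbers_at w) b' a' u \<and> ray_in (numbers_at w) b' c' v \<and>
      ray_in (numbers_at w) y x u' \<and> ray_in (numbers_at w) y z v' \<and>
      dist b' u = dist y u' \<and> dist b' v = dist y v' \<and> dist u v = dist u' v' \<and> b' \<noteq> u \<and> b' \<noteq> v"
      using cong(1) by (simp add: angle_cong_def Let_def numeral_eq_Suc a'_def b'_def c'_def)
    then obtain u v u' v' where ray: "ray_in (numbers_at w) b' a' u" "ray_in (numbers_at w) b' c' v"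
      and ray': "ray_in (numbers_at w) y x u'" "ray_in (numbers_at w) y z v'"
      and eq: "dist b' u = dist y u'" "dist b' v = dist y v'" "dist u v = dist u' v'"
      and ne: "b' \<noteq> u" "b' \<noteq> v"
      by blast
    have ne': "u' \<noteq> y" "v' \<noteq> y"
      using eq ne by auto
    have "cosine a' b' c' = cosine x y z"
      using cosine_rays[OF ray] cosine_rays[OF ray' ne'] cosine_cong[OF eq] ne by auto
    moreover have "cosine x y z \<in> numbers_at w \<and> cosine x y z < 1"
      using cong(2)
    proof
      assume "point_forces w (case_nat z (case_nat y (case_nat x e))) (R (Var 1) (Var 2) (Var 0))"
      note R = point_forces_R[OF this, simplified numeral_eq_Suc, simplified]
      from cosine_right_triangle[OF R(7)] R show ?thesis
        by (simp add: dist_commute)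
    next
      assume "point_forces w (case_nat z (case_nat y (case_nat x e))) (R (Var 1) (Var 0) (Var 2))"
      note R = point_forces_R[OF this, simplified numeral_eq_Suc, simplified]
      from cosine_right_triangle[OF R(7)] R show ?thesis
        by (simp add: dist_commute cosine_commute[of x y z])
    qed
    ultimately show ?thesis
      using ray_inD(1,2)[OF ray(1)] ray_inD(1,2)[OF ray(2)] by (auto simp: angle_in_def)
  qed
qed

text \<open>An angle is less than \<pi> when its supplement is positive. The supplement has the
  negated cosine, so the upper bound 1 for it becomes the lower bound -1.\<close>

lemma point_forces_proper_angle:
  assumes "point_forces w e (proper_angle a b c)"
  shows "proper_in (numbers_at w) (point_val e a) (point_val e b) (point_val e c)"
proof -
  define a' b' c' where "a' = point_val e a" and "b' = point_val e b" and "c' = point_val e c"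
  have pos: "angle_in (numbers_at w) a' b' c'" "cosine a' b' c' < 1"
    using assms point_forces_pos_angle unfolding proper_angle_def forces.simps a'_def b'_def c'_def
    by blast+
  obtain d where d: "btw (numbers_at w) a' b' d"
      "point_forces w (case_nat d e) (pos_angle (Var 0) (b \<up> 1) (c \<up> 1))"
    using assms by (auto simp: proper_angle_def angle_less_pi_def Let_def a'_def b'_def)
  have less: "cosine d b' c' < 1"
    using point_forces_pos_angle[OF d(2)] by (simp add: b'_def c'_def)
  have "a' \<noteq> b'" "b' \<in> closed_segment a' d" "b' \<noteq> d"
    using d(1) by (auto simp: btw_def open_segment_def)
  have "d - b' = (- (dist b' d / dist a' b')) *\<^sub>R (a' - b')"
    unfolding in_closed_segment_beyond(3)[OF \<open>a' \<noteq> b'\<close> \<open>b' \<in> closed_segment a' d\<close>]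
    by (simp add: algebra_simps)
  then have "cosine d b' c' = - cosine a' b' c'"
    by (rule cosine_opposite) (use \<open>a' \<noteq> b'\<close> \<open>b' \<noteq> d\<close> in simp)
  then show ?thesis
    using pos less by (simp add: proper_in_def a'_def b'_def c'_def)
qed

section \<open>Verification of the axioms of EG\<close>

lemma point_forces_congruence: "\<phi> \<in> congruence_axioms \<Longrightarrow> point_forces w e \<phi>"
  by (auto simp: congruence_axioms_def Let_def dist_commute intro!: forces_ImpI)

text \<open>The negated hypotheses of the last axiom are decided at the top, so they deny membership
  in ordinary open segments.\<close>

lemma point_forces_betweenness: "\<phi> \<in> betweenness_axioms \<Longrightarrow> point_forces w e \<phi>"
  by (auto simp: betweenness_axioms_def Let_def not_btw_refl
      intro!: forces_ImpI intro: btw_commute[THEN iffD1] btw_inner_trans)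
    (auto simp: btw_def intro: open_segment_connectivity)

text \<open>Extension for \<open>T\<close>, with arbitrary lengths: for distinct c and d it is
  \<open>btw_extension\<close> at the top world.\<close>

lemma segment_extension:
  fixes a b c d :: "'a::real_inner"
  assumes "a \<noteq> b"
  shows "\<exists>e. b \<in> closed_segment a e \<and> dist b e = dist c d"
proof (cases "c = d")
  case True
  then show ?thesis by (intro exI[of _ b]) simp
next
  case False
  then show ?thesis
    using K.btw_extension[of a b True c d] assms by (auto simp: btw_def intro: open_closed_segment)
qed

lemma point_forces_extension:
  assumes "\<phi> \<in> extension_axioms"
  shows "point_forces w e \<phi>"
  using assms unfolding extension_axioms_def Let_def
  apply (elim insertE emptyE; hypsubst; intro forces_ImpI)
   apply (simp, metis segment_extension zero_less_dist_iff)
  apply (simp, metis K.btw_extension zero_less_dist_iff)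
  done

lemma point_forces_five_segment: "point_forces w e five_segment"
  unfolding five_segment_def Let_def
  by (rule forces_ImpI) (auto intro: five_segment_inner_space)

lemma point_forces_inner_Pasch: "point_forces w e inner_Pasch"
  unfolding inner_Pasch_def Let_def
  by (rule forces_ImpI) (auto dest!: point_forces_proper_angle intro: K.inner_Pasch_btw)

lemma point_forces_outer_Pasch: "point_forces w e outer_Pasch"
  unfolding outer_Pasch_def Let_def
  by (rule forces_ImpI) (auto dest!: point_forces_proper_angle intro: K.outer_Pasch_btw)

text \<open>The endpoints \<open>u\<close> and \<open>v\<close> of the given diameter are themselves a solution.\<close>

lemma point_forces_line_circle:
  assumes "\<phi> \<in> line_circle_axioms"
  shows "point_forces w e \<phi>"
  using assms unfolding line_circle_axioms_def Let_def
  apply (elim insertE emptyE; hypsubst; intro forces_ImpI)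
   apply (simp, blast)
  apply (simp, blast)
  done

text \<open>The point a lies in the disk around c' because disks are convex, and b lies outside
  because w is on the circle between c' and b.\<close>

lemma circle_circle_btw:
  fixes a b c c' u v w :: complex
  assumes "dist c a = \<rho>" "a \<in> closed_segment u v" "dist c' u = \<rho>'" "dist c' v = \<rho>'"
    and "dist c b = \<rho>" "btw K c' w b" "dist c' w = \<rho>'"
  shows "\<exists>e. dist c e = \<rho> \<and> dist c' e = \<rho>'"
proof (rule circle_circle_euclidean)
  have "closed_segment u v \<subseteq> cball c' \<rho>'"
    using assms by (intro closed_segment_subset convex_cball) simp_all
  then show "dist c' a \<le> \<rho>'"
    using assms(2) by auto
  have "c' \<noteq> w" "w \<in> closed_segment c' b"
    using assms(6) by (auto simp: btw_def open_segment_def)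
  from in_closed_segment_beyond(2)[OF this] show "\<rho>' \<le> dist c' b"
    using assms(7) by simp
qed (use assms in simp_all)

lemma point_forces_circle_circle: "point_forces w e circle_circle"
  unfolding circle_circle_def Let_def
  by (rule forces_ImpI) (auto intro: circle_circle_btw[where a = "e 0" and b = "e 1" and u = "e 5" and v = "e 6" and w = "e 7"])

lemma point_forces_Euclid5: "point_forces w e Euclid5"
  unfolding Euclid5_def Let_def
  by (rule forces_ImpI) (auto intro: K.Euclid5_btw)

lemma point_forces_lower_dimension:
  assumes "\<phi> \<in> lower_dimension_axioms"
  shows "point_forces w e \<phi>"
proof -
  have sides: "dist (2 :: complex) (Complex 1 (sqrt 3)) = 2" "cmod (Complex 1 (sqrt 3)) = 2"
    "cmod (Complex (- 1) (sqrt 3)) = 2" "cmod (Complex (- (3 / 2)) (sqrt 3 / 2)) = sqrt 3"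
    by (simp_all add: dist_norm cmod_def power_divide)
  have mids: "dist 0 (Complex (1 / 2) (sqrt 3 / 2)) = dist (Complex (1 / 2) (sqrt 3 / 2)) (Complex 1 (sqrt 3))"
    "dist 2 (Complex (3 / 2) (sqrt 3 / 2)) = dist (Complex (3 / 2) (sqrt 3 / 2)) (Complex 1 (sqrt 3))"
    "dist (1 :: complex) 2 = 1"
    by (simp_all add: dist_norm cmod_def power_divide power2_eq_square)
  have diffs: "Complex 1 (sqrt 3) - 2 = Complex (- 1) (sqrt 3)"
    "Complex (1 / 2) (sqrt 3 / 2) - 2 = Complex (- (3 / 2)) (sqrt 3 / 2)"
    "1 - Complex 1 (sqrt 3) = Complex 0 (- sqrt 3)"
    by (simp_all add: complex_eq_iff)
  have "btw (numbers_at w) 0 1 (2 :: complex)"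
    by (rule K.btw_intro[where t = "1 / 2"]) (simp_all add: complex_eq_iff)
  moreover have "btw (numbers_at w) 0 (Complex (1 / 2) (sqrt 3 / 2)) (Complex 1 (sqrt 3))"
    by (rule K.btw_intro[where t = "1 / 2"]) (simp_all add: sides complex_eq_iff)
  moreover have "btw (numbers_at w) 2 (Complex (3 / 2) (sqrt 3 / 2)) (Complex 1 (sqrt 3))"
    by (rule K.btw_intro[where t = "1 / 2"]) (simp_all add: diffs sides complex_eq_iff)
  \<comment> \<open>The centroid lies at two thirds of each median, measured from the
    vertex.\<close>
  moreover have "btw (numbers_at w) 2 (Complex 1 (sqrt 3 / 3)) (Complex (1 / 2) (sqrt 3 / 2))"
    by (rule K.btw_intro[where t = "2 / 3"]) (simp_all add: diffs sides complex_eq_iff)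
  moreover have "btw (numbers_at w) (Complex 1 (sqrt 3)) (Complex 1 (sqrt 3 / 3)) 1"
    by (rule K.btw_intro[where t = "2 / 3"]) (simp_all add: diffs cmod_def complex_eq_iff)
  ultimately show ?thesis
    using assms sides mids
    unfolding lower_dimension_axioms_def Let_def by (elim insertE emptyE) simp_all
qed

lemma point_forces_EG:
  assumes "\<phi> \<in> EG_axioms"
  shows "point_forces w e \<phi>"
  using _ assms unfolding EG_axioms_def
  by (rule forces_closure)
    (auto intro: point_forces_congruence point_forces_betweenness point_forces_extension
      point_forces_five_segment point_forces_inner_Pasch point_forces_outer_Pasch
      point_forces_lower_dimension point_forces_line_circle point_forces_circle_circle
      point_forces_Euclid5)

lemma point_forces_not_Markov: "\<not> point_forces False e geometric_Markov"
proof -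
  obtain x :: real where x: "0 < x" "x \<notin> constructible"
    using positive_not_constructible by blast
  \<comment> \<open>This makes the distance from 1 to y equal to the nonconstructible x.\<close>
  define y where "y = 1 + x"
  have y: "1 < y" "y - 1 \<notin> constructible"
    using x by (simp_all add: y_def)
  have "1 \<in> open_segment 0 (complex_of_real y)"
    using y(1) of_real_open_segment[of 1 0 y, where 'a = complex]
    by (simp add: open_segment_eq_real_ivl)
  then have "btw UNIV 0 1 (complex_of_real y)"
    by (simp add: btw_def)
  moreover have "dist 1 (complex_of_real y) = y - 1"
    using dist_of_real[of 1 y, where 'a = complex] y(1) by (simp add: dist_real_def)
  then have "\<not> btw constructible 0 1 (complex_of_real y)"
    unfolding btw_def using y(2) by simp
  moreover have "btw constructible 0 1 (complex_of_real y)"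
    if M: "point_forces False e geometric_Markov" and top: "btw UNIV 0 1 (complex_of_real y)"
  proof -
    let ?e = "case_nat (complex_of_real y) (case_nat 1 (case_nat 0 e))"
    have "point_forces False ?e (\<^bold>\<not> \<^bold>\<not> B (Var 2) (Var 1) (Var 0) \<^bold>\<longrightarrow> B (Var 2) (Var 1) (Var 0))"
      using M unfolding geometric_Markov_def Let_def forces.simps(7) by blast
    moreover have "point_forces False ?e (\<^bold>\<not> \<^bold>\<not> B (Var 2) (Var 1) (Var 0))"
      using top by simp
    ultimately have "point_forces False ?e (B (Var 2) (Var 1) (Var 0))"
      unfolding forces.simps(6)[of _ _ _ _ "\<^bold>\<not> \<phi>" for \<phi>] by blast
    then show ?thesis by simp
  qed
  ultimately show ?thesis
    by blast
qed

theorem theorem9p1: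
  shows "\<not> deriv field_fun_arity field_rel_arity weakly_Euclidean_field_axioms field_Markov \<and>
         \<not> deriv point_const_arity point_rel_arity EG_axioms geometric_Markov"
proof (intro conjI notI)
  assume "deriv field_fun_arity field_rel_arity weakly_Euclidean_field_axioms field_Markov"
  from soundness[OF persistent_field_holds this] show False
    using field_forces_axioms field_forces_not_Markov by blast
next
  assume "deriv point_const_arity point_rel_arity EG_axioms geometric_Markov"
  from soundness[OF persistent_point_holds this] show False
    using point_forces_EG point_forces_not_Markov by blast
qed

end
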